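(* The sequence of normalized random variables $$Z_n:=\frac{f_0(T_n)-\mathbb{E}f_0(T_n)}{\sqrt{\operatorname{var}(f_0(T_n))}},\qquad n\ge2,$$ satisfies $$\sup_{x\in\mathbb{R}}\bigl|\mathbb{P}(Z_n\le x)-\Phi(x)\bigr|=O\Big(\frac{1}{\sqrt{\log n}}\Big)\qquad\text{as } n\to\infty,$$ where $\Phi(x)=\frac1{\sqrt{2\pi}}\int_{-\infty}^x e^{-y^2/2}\,dy$.
   Context: Let $T\subset\mathbb{R}^2$ be the triangle with vertices $(0,0)$, $\mathbf{v}_1=(1,0)$, $\mathbf{v}_2=(0,1)$. For $n\ge 0$ let $\mathbf{X}_1,\dots,\mathbf{X}_n$ be independent uniformly distributed random points in $T$ and $T_n:=\operatorname{conv}\{\mathbf{v}_1,\mathbf{v}_2,\mathbf{X}_1,\dots,\mathbf{X}_n\}$. $f_0(T_n)$ is the number of vertices of $T_n$ (including $\mathbf{v}_1,\mathbf{v}_2$). *)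

theory Defs
  imports "HOL-Probability.Probability" "HOL-Library.Landau_Symbols"
begin

definition std_triangle :: "(real \<times> real) set" where
  "std_triangle = convex hull {(0, 0), (1, 0), (0, 1)}"

definition random_polygon :: "(nat \<Rightarrow> 'a \<Rightarrow> real \<times> real) \<Rightarrow> nat \<Rightarrow> 'a \<Rightarrow> (real \<times> real) set" where
  "random_polygon X n \<omega> = convex hull ({(1, 0), (0, 1)} \<union> (\<lambda>i. X i \<omega>) ` {1..n})"

definition num_vertices :: "(real \<times> real) set \<Rightarrow> nat" where
  "num_vertices P = card {v. v extreme_point_of P}"

text \<open>Degenerate case: the result is constantly 0 if the variance of \<open>Y\<close> vanishes, since
  division by 0 yields 0.\<close>

definition normalize_rv :: "'a measure \<Rightarrow> ('a \<Rightarrow> real) \<Rightarrow> 'a \<Rightarrow> real" where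
  "normalize_rv M Y \<omega> =
    (Y \<omega> - prob_space.expectation M Y) / sqrt (prob_space.variance M Y)"

definition std_normal_cdf :: "real \<Rightarrow> real" where
  "std_normal_cdf x = 1 / sqrt (2 * pi) * (LBINT y:{..x}. exp (- y\<^sup>2 / 2))"

end

theory Submission
  imports Defs "HOL-Real_Asymp.Real_Asymp" "HOL-Computational_Algebra.Fundamental_Theorem_Algebra"
begin

text \<open>The proof shows that the number of vertices has, up to the shift by 2, exactly the law of a sum of
independent, not identically distributed Bernoulli variables whose variance is at least a constant
times \<open>ln n\<close>, and then applies a Berry-Esseen bound of order \<open>1 / \<sigma>\<close> to that sum.

The law. Look at the \<open>n\<close> points from \<open>v\<^sub>1 = (1, 0)\<close> and let \<open>w\<close> be the one seen under the lowest angle;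
almost surely it is unique, and it is the neighbour of \<open>v\<^sub>1\<close> on the convex chain. The line through
\<open>v\<^sub>1\<close> and \<open>w\<close> cuts off the triangle that contains all other points. Those inside the triangle
\<open>v\<^sub>1, w, v\<^sub>2\<close> do not matter, and the remaining ones, given their number \<open>m\<close>, are independent and
uniform in the triangle spanned by \<open>w\<close>, \<open>v\<^sub>2\<close> and the intersection of the line with the \<open>y\<close>-axis.
An affine map carries this triangle to \<open>T\<close> and \<open>w\<close> to \<open>v\<^sub>1\<close>, so the rest of the chain is a copy
of the original problem with \<open>m\<close> points (\<open>nn_integral_corner_condition\<close>). Integrating over \<open>w\<close>
gives \<open>m\<close> the probability \<open>2 (n - m) / (n (n + 1))\<close> (\<open>pgf_lowest_term\<close>), hence the generating functions
\<open>G\<^sub>n(z) = E z\<^sup>N\<close> of the number \<open>N\<close> of vertices other than \<open>v\<^sub>1, v\<^sub>2\<close> satisfy the renewal equation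
\<open>n (n + 1) G\<^sub>n = 2 z \<Sum>\<^sub>m\<^sub><\<^sub>n (n - m) G\<^sub>m\<close> (\<open>pgf_chain_vertices\<close>).

Real zeros. The second difference of the renewal equation is a three-term recurrence of the kind
that orthogonal polynomials satisfy. The Christoffel-Darboux argument then excludes nonreal zeros,
positive zeros are impossible because all coefficients are nonnegative, and so \<open>G\<^sub>n\<close> is a product of factors
\<open>1 - p + p z\<close> with \<open>0 \<le> p \<le> 1\<close> (\<open>chain_poly_bernoulli\<close>): this is the sum of Bernoulli variables.
Differentiating the recurrence at \<open>z = 1\<close> gives recurrences for mean and variance, from which the
variance grows in step \<open>n\<close> by at least \<open>10 / (27 (n + 1))\<close> (\<open>chain_var_increment\<close>).

Berry-Esseen (\<open>berry_esseen_bernoulli\<close>). For a sum \<open>S\<close> of Bernoulli variables with standardisation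
\<open>W\<close>, Stein's zero-bias variable \<open>W\<^sup>*\<close> can be realised on the same space with
\<open>\<bar>W - W\<^sup>*\<bar> \<le> 1 / \<sigma>\<close>. Stein's equation turns \<open>P(W\<^sup>* \<le> x) - \<Phi>(x)\<close> into
\<open>E (W f(W) - W\<^sup>* f(W\<^sup>*))\<close>, which is of order \<open>1 / \<sigma>\<close> because \<open>f\<close> is bounded and Lipschitz; replacing
\<open>W\<^sup>*\<close> by \<open>W\<close> in the event moves the threshold by \<open>1 / \<sigma>\<close> only.\<close>

section \<open>Sums of Bernoulli variables and their zero-bias transform\<close>

text \<open>Only expectations of functions of a sum \<open>S\<close> of independent Bernoulli variables with success
probabilities \<open>ps\<close> are needed, so the law is represented by the expectation functional
\<open>f \<mapsto> E f(S)\<close>, obtained by conditioning on one variable after the other; this makes the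
identities of this section inductions on the list.\<close>

primrec bexp :: "real list \<Rightarrow> (nat \<Rightarrow> real) \<Rightarrow> real" where
  "bexp [] f = f 0"
| "bexp (p # ps) f = (1 - p) * bexp ps f + p * bexp ps (\<lambda>k. f (Suc k))"

text \<open>With \<open>S\<^sub>-\<^sub>i\<close> the sum without the \<open>i\<close>-th variable, this is \<open>\<Sum>\<^sub>i p\<^sub>i (1 - p\<^sub>i) E h(S\<^sub>-\<^sub>i)\<close>, unfolded along the list:
the first summand omits the first variable, the other two condition on its value. Up to the
normalisation by the total mass \<open>bvar ps\<close> it is the law of \<open>S\<close> with one variable removed, the index
being chosen with probability proportional to its variance. Adding a uniform variable on \<open>[0, 1]\<close>
yields the zero-bias distribution of \<open>S\<close>.\<close>

primrec zbias :: "real list \<Rightarrow> (nat \<Rightarrow> real) \<Rightarrow> real" where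
  "zbias [] h = 0"
| "zbias (p # ps) h = p * (1 - p) * bexp ps h + (1 - p) * zbias ps h + p * zbias ps (\<lambda>k. h (Suc k))"

definition bmean :: "real list \<Rightarrow> real" where "bmean ps = sum_list ps"
definition bvar :: "real list \<Rightarrow> real" where "bvar ps = (\<Sum>p\<leftarrow>ps. p * (1 - p))"

lemma bmean_simps [simp]: "bmean [] = 0" "bmean (p # ps) = p + bmean ps"
  by (simp_all add: bmean_def)

lemma bvar_simps [simp]: "bvar [] = 0" "bvar (p # ps) = p * (1 - p) + bvar ps"
  by (simp_all add: bvar_def)

lemma bexp_add: "bexp ps (\<lambda>k. f k + g k) = bexp ps f + bexp ps g"
  by (induction ps arbitrary: f g) (simp_all add: algebra_simps)

lemma bexp_cmult: "bexp ps (\<lambda>k. c * f k) = c * bexp ps f"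
  by (induction ps arbitrary: f) (simp_all add: algebra_simps)

lemma bexp_const [simp]: "bexp ps (\<lambda>k. c) = c"
  by (induction ps) (simp_all add: algebra_simps)

lemma bexp_diff: "bexp ps (\<lambda>k. f k - g k) = bexp ps f - bexp ps g"
  using bexp_add[of ps f "\<lambda>k. -1 * g k"] bexp_cmult[of ps "-1" g] by simp

lemma zbias_add: "zbias ps (\<lambda>k. f k + g k) = zbias ps f + zbias ps g"
  by (induction ps arbitrary: f g) (simp_all add: bexp_add algebra_simps)

lemma zbias_cmult: "zbias ps (\<lambda>k. c * f k) = c * zbias ps f"
  by (induction ps arbitrary: f) (simp_all add: bexp_cmult algebra_simps)

lemma zbias_diff: "zbias ps (\<lambda>k. f k - g k) = zbias ps f - zbias ps g"
  using zbias_add[of ps f "\<lambda>k. -1 * g k"] zbias_cmult[of ps "-1" g] by simp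

lemma zbias_const: "zbias ps (\<lambda>k. c) = c * bvar ps"
  by (induction ps) (simp_all add: algebra_simps)

abbreviation is_probs :: "real list \<Rightarrow> bool" where
  "is_probs ps \<equiv> (\<forall>p\<in>set ps. 0 \<le> p \<and> p \<le> 1)"

lemma bexp_mono:
  assumes "is_probs ps" "\<And>k. f k \<le> g k"
  shows "bexp ps f \<le> bexp ps g"
  using assms
  by (induction ps arbitrary: f g) (auto intro!: add_mono mult_left_mono)

text \<open>The discrete form of the defining property \<open>E (S - \<mu>) f(S) = \<sigma>\<^sup>2 E f'(S\<^sup>*)\<close> of zero biasing: for a single
Bernoulli variable \<open>B\<close> with parameter \<open>p\<close> one has \<open>E (B - p) g(B) = p (1 - p) (g(1) - g(0))\<close>.\<close>

lemma zbias_characterization: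
  "bexp ps (\<lambda>k. (real k - bmean ps) * f k) = zbias ps (\<lambda>k. f (Suc k) - f k)"
proof (induction ps arbitrary: f)
  case (Cons p ps)
  have 1: "bexp ps (\<lambda>k. (real k - (p + bmean ps)) * f k)
      = bexp ps (\<lambda>k. (real k - bmean ps) * f k) - p * bexp ps f"
    by (simp add: bexp_cmult[symmetric] bexp_diff[symmetric] algebra_simps)
  have 2: "bexp ps (\<lambda>k. (real (Suc k) - (p + bmean ps)) * f (Suc k))
      = bexp ps (\<lambda>k. (real k - bmean ps) * f (Suc k)) + (1 - p) * bexp ps (\<lambda>k. f (Suc k))"
    by (simp add: bexp_cmult[symmetric] bexp_add[symmetric] algebra_simps)
  show ?case
    unfolding bexp.simps zbias.simps bmean_simps 1 2 Cons.IH
    by (simp add: bexp_diff algebra_simps)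
qed auto

lemma bexp_variance: "bexp ps (\<lambda>k. (real k - bmean ps)\<^sup>2) = bvar ps"
proof -
  have "bexp ps (\<lambda>k. (real k - bmean ps)\<^sup>2) =
      bexp ps (\<lambda>k. (real k - bmean ps) * (real k - bmean ps))"
    by (simp add: power2_eq_square)
  also have "\<dots> = bvar ps"
    unfolding zbias_characterization by (simp add: zbias_const)
  finally show ?thesis .
qed

lemma bexp_mean: "bexp ps (\<lambda>k. real k) = bmean ps"
proof -
  have "bexp ps (\<lambda>k. (real k - bmean ps) * 1) = 0"
    unfolding zbias_characterization by (simp add: zbias_const)
  thus ?thesis by (simp add: bexp_diff)
qed

text \<open>The coupling: \<open>S\<close> equals \<open>S\<^sub>-\<^sub>i\<close> or \<open>S\<^sub>-\<^sub>i + 1\<close>, so a function of \<open>S\<close> that is dominated in both cases by a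
function of \<open>S\<^sub>-\<^sub>i\<close> has the smaller expectation.\<close>

lemma zbias_coupling:
  assumes "is_probs ps" "\<And>j. u j \<le> v j" "\<And>j. u (Suc j) \<le> v j"
  shows "bvar ps * bexp ps u \<le> zbias ps v"
  using assms
proof (induction ps arbitrary: u v)
  case (Cons p ps)
  have p: "0 \<le> p" "p \<le> 1" "is_probs ps" using Cons.prems by auto
  have IH1: "bvar ps * bexp ps u \<le> zbias ps v"
    by (intro Cons.IH) (use Cons.prems in auto)
  have IH2: "bvar ps * bexp ps (\<lambda>k. u (Suc k)) \<le> zbias ps (\<lambda>k. v (Suc k))"
    by (intro Cons.IH) (use Cons.prems in auto)
  have b1: "bexp ps u \<le> bexp ps v" by (intro bexp_mono) (use Cons.prems in auto)
  have b2: "bexp ps (\<lambda>k. u (Suc k)) \<le> bexp ps v" by (intro bexp_mono) (use Cons.prems in auto)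
  have "(1 - p) * bexp ps u + p * bexp ps (\<lambda>k. u (Suc k))
        \<le> (1 - p) * bexp ps v + p * bexp ps v"
    by (intro add_mono mult_left_mono b1 b2) (use p in auto)
  hence "(p * (1 - p)) * ((1 - p) * bexp ps u + p * bexp ps (\<lambda>k. u (Suc k)))
        \<le> (p * (1 - p)) * bexp ps v"
    by (intro mult_left_mono) (use p in \<open>auto simp flip: distrib_right\<close>)
  moreover have "(1 - p) * (bvar ps * bexp ps u) + p * (bvar ps * bexp ps (\<lambda>k. u (Suc k)))
      \<le> (1 - p) * zbias ps v + p * zbias ps (\<lambda>k. v (Suc k))"
    by (intro add_mono mult_left_mono IH1 IH2) (use p in auto)
  ultimately show ?case by (simp add: algebra_simps)
qed auto

section \<open>The normal distribution and the solution of the Stein equation\<close>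

abbreviation \<phi> where "\<phi> \<equiv> std_normal_density"
abbreviation \<Phi> where "\<Phi> \<equiv> std_normal_cdf"

lemma std_normal_cdf_eq: "\<Phi> x = measure std_normal_distribution {..x}"
proof -
  have "emeasure std_normal_distribution {..x} = (\<integral>\<^sup>+y. ennreal (\<phi> y * indicator {..x} y) \<partial>lborel)"
    by (subst emeasure_density) (auto intro!: nn_integral_cong simp: indicator_def)
  also have "\<dots> = ennreal (\<integral>y. \<phi> y * indicator {..x} y \<partial>lborel)"
    by (intro nn_integral_eq_integral integrable_real_mult_indicator) auto
  finally have "measure std_normal_distribution {..x} = (\<integral>y. \<phi> y * indicator {..x} y \<partial>lborel)"
    by (simp add: measure_def)
  also have "\<dots> = (\<integral>y. 1 / sqrt (2 * pi) * (indicator {..x} y *\<^sub>R exp (- y\<^sup>2 / 2)) \<partial>lborel)"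
    by (intro Bochner_Integration.integral_cong) (auto simp: std_normal_density_def)
  also have "\<dots> = \<Phi> x"
    by (simp add: std_normal_cdf_def set_lebesgue_integral_def)
  finally show ?thesis ..
qed

lemma std_normal_cdf_diff:
  assumes "a \<le> b"
  shows "\<Phi> b - \<Phi> a = integral {a..b} \<phi>"
proof -
  interpret real_distribution std_normal_distribution by (rule real_dist_normal_dist)
  have "\<Phi> b - \<Phi> a = measure std_normal_distribution {a<..b}"
  proof -
    have "{a<..b} = {..b} - {..a}" by auto
    thus ?thesis using assms by (simp add: std_normal_cdf_eq finite_measure_Diff)
  qed
  also have "\<dots> = (\<integral>y. \<phi> y * indicator {a..b} y \<partial>lborel)"
  proof -
    have "emeasure std_normal_distribution {a<..b} = (\<integral>\<^sup>+y. ennreal (\<phi> y * indicator {a..b} y) \<partial>lborel)"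
      by (subst emeasure_density)
         (auto intro!: nn_integral_cong_AE AE_I[where N="{a}"] simp: indicator_def split: split_of_bool_asm)
    also have "\<dots> = ennreal (\<integral>y. \<phi> y * indicator {a..b} y \<partial>lborel)"
      by (intro nn_integral_eq_integral integrable_real_mult_indicator) auto
    finally show ?thesis by (simp add: measure_def)
  qed
  also have "\<dots> = integral {a..b} \<phi>"
    by (subst set_borel_integral_eq_integral(2)[symmetric])
       (auto simp: set_integrable_def set_lebesgue_integral_def mult.commute
        intro!: integrable_real_mult_indicator)
  finally show ?thesis .
qed

lemma std_normal_cdf_deriv: "(\<Phi> has_real_derivative \<phi> x) (at x)"
proof -
  have cont: "continuous_on A \<phi>" for A
    unfolding std_normal_density_def by (intro continuous_intros) auto
  have "((\<lambda>u. integral {x - 1..u} \<phi>) has_real_derivative \<phi> x) (at x within {x-1..x+1})"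
    by (intro integral_has_real_derivative cont) auto
  hence "((\<lambda>u. integral {x - 1..u} \<phi>) has_real_derivative \<phi> x) (at x)"
    by (subst (asm) at_within_interior) (auto simp: interior_atLeastAtMost_real)
  hence D: "((\<lambda>u. \<Phi> (x - 1) + integral {x - 1..u} \<phi>) has_real_derivative \<phi> x) (at x)"
    by (auto intro!: derivative_eq_intros)
  show ?thesis
  proof (rule DERIV_cong_ev[THEN iffD1, OF refl _ refl D])
    show "\<forall>\<^sub>F u in nhds x. \<Phi> (x - 1) + integral {x - 1..u} \<phi> = \<Phi> u"
      using eventually_nhds_in_open[of "{x-1<..}" x]
      by (auto elim!: eventually_mono simp: std_normal_cdf_diff[symmetric])
  qed
qed

lemma std_normal_density_deriv: "(\<phi> has_real_derivative - x * \<phi> x) (at x)"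
proof -
  define c where "c = 1 / sqrt (2 * pi)"
  have "\<phi> = (\<lambda>x. c * exp (- x\<^sup>2 / 2))" by (simp add: fun_eq_iff std_normal_density_def c_def)
  thus ?thesis by (auto intro!: derivative_eq_intros)
qed

lemma std_normal_cdf_range: "0 \<le> \<Phi> x" "\<Phi> x \<le> 1"
  using real_distribution.axioms(1)[OF real_dist_normal_dist]
  by (auto simp: std_normal_cdf_eq intro: prob_space.prob_le_1)

lemma std_normal_cdf_at_top: "(\<Phi> \<longlongrightarrow> 1) at_top"
  using real_distribution.cdf_lim_at_top_prob[OF real_dist_normal_dist]
  by (simp add: cdf_def2 std_normal_cdf_eq[abs_def] cdf_def)

lemma std_normal_cdf_at_bot: "(\<Phi> \<longlongrightarrow> 0) at_bot"
  using finite_borel_measure.cdf_lim_at_bot[of std_normal_distribution]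
    real_distribution.finite_borel_measure_M[OF real_dist_normal_dist]
  by (simp add: cdf_def2 std_normal_cdf_eq[abs_def] cdf_def)

lemma std_normal_density_at_top: "(\<phi> \<longlongrightarrow> 0) at_top"
  unfolding std_normal_density_def by real_asymp

lemma std_normal_cdf_lipschitz: "\<Phi> (x + d) - \<Phi> x \<le> d" if d: "d \<ge> 0"
proof (cases "d = 0")
  case False
  then obtain z where "\<Phi> (x + d) - \<Phi> x = (x + d - x) * \<phi> z"
    using MVT2[of x "x + d" \<Phi> \<phi>] std_normal_cdf_deriv d False by auto
  moreover have "\<phi> z \<le> 1"
  proof -
    have "1 / sqrt (2 * pi) \<le> 1" using pi_ge_two by (simp add: real_le_rsqrt)
    thus ?thesis unfolding std_normal_density_def by (intro mult_le_one) auto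
  qed
  ultimately show ?thesis using d by (simp add: mult_left_le)
qed auto

lemma std_normal_density_pos: "0 < \<phi> x"
  by (simp add: normal_density_pos)

text \<open>The difference of the two sides, divided by \<open>x\<close>, has derivative \<open>- \<phi>(x) / x\<^sup>2\<close> and tends to 0.\<close>

lemma mills_ratio_upper:
  assumes "x > 0"
  shows "x * (1 - \<Phi> x) \<le> \<phi> x"
proof -
  have "0 < \<phi> x / x - (1 - \<Phi> x)"
  proof (rule DERIV_neg_imp_decreasing_at_top[where f = "\<lambda>y. \<phi> y / y - (1 - \<Phi> y)"])
    fix y assume "x \<le> y"
    with assms have y: "y > 0" by simp
    have "((\<lambda>y. \<phi> y / y - (1 - \<Phi> y)) has_real_derivative - (\<phi> y / y\<^sup>2)) (at y)"
      using y by (auto intro!: derivative_eq_intros std_normal_density_deriv std_normal_cdf_deriv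
          simp: field_simps power2_eq_square)
    thus "\<exists>d. ((\<lambda>y. \<phi> y / y - (1 - \<Phi> y)) has_real_derivative d) (at y) \<and> d < 0"
      using y std_normal_density_pos[of y] by (intro exI[of _ "- (\<phi> y / y\<^sup>2)"]) auto
  next
    have "((\<lambda>y. \<phi> y * inverse y - (1 - \<Phi> y)) \<longlongrightarrow> 0 * 0 - (1 - 1)) at_top"
      by (intro tendsto_intros std_normal_density_at_top std_normal_cdf_at_top
          tendsto_inverse_0_at_top filterlim_ident)
    thus "((\<lambda>y. \<phi> y / y - (1 - \<Phi> y)) \<longlongrightarrow> 0) at_top"
      by (simp add: field_simps)
  qed
  thus ?thesis using assms by (simp add: field_simps)
qed

lemma mills_ratio_lower:
  assumes "x < 0"
  shows "- x * \<Phi> x \<le> \<phi> x"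
proof -
  have "0 < \<phi> x / (- x) - \<Phi> x"
  proof (rule DERIV_pos_imp_increasing_at_bot[where f = "\<lambda>y. \<phi> y / (- y) - \<Phi> y"])
    fix y assume "y \<le> x"
    with assms have y: "y < 0" by simp
    have "((\<lambda>y. \<phi> y / (- y) - \<Phi> y) has_real_derivative (\<phi> y / y\<^sup>2)) (at y)"
      using y by (auto intro!: derivative_eq_intros std_normal_density_deriv std_normal_cdf_deriv
          simp: field_simps power2_eq_square)
    thus "\<exists>d. ((\<lambda>y. \<phi> y / (- y) - \<Phi> y) has_real_derivative d) (at y) \<and> 0 < d"
      using y std_normal_density_pos[of y] by (intro exI[of _ "\<phi> y / y\<^sup>2"] conjI) (assumption, simp)
  next
    have *: "(\<phi> \<longlongrightarrow> 0) at_bot" unfolding std_normal_density_def by real_asymp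
    have "((\<lambda>y. \<phi> y * - inverse y - \<Phi> y) \<longlongrightarrow> 0 * - 0 - 0) at_bot"
      by (intro tendsto_intros * std_normal_cdf_at_bot) real_asymp
    thus "((\<lambda>y. \<phi> y / (- y) - \<Phi> y) \<longlongrightarrow> 0) at_bot"
      by (simp add: field_simps)
  qed
  thus ?thesis using assms by (simp add: field_simps)
qed

text \<open>For fixed \<open>x\<close> this is the bounded solution of the Stein equation
\<open>f'(y) - y f(y) = 1\<^bsub>y \<le> x\<^esub> - \<Phi>(x)\<close>; it has a kink at \<open>x\<close>.\<close>

definition stein_sol :: "real \<Rightarrow> real \<Rightarrow> real" where
  "stein_sol x y = (if y \<le> x then \<Phi> y * (1 - \<Phi> x) else \<Phi> x * (1 - \<Phi> y)) / \<phi> y"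

lemma std_normal_cdf_mono: "x \<le> y \<Longrightarrow> \<Phi> x \<le> \<Phi> y"
  using DERIV_nonneg_imp_nondecreasing[of x y \<Phi>] std_normal_cdf_deriv std_normal_density_pos
  by (metis less_imp_le)

lemma stein_sol_nonneg: "0 \<le> stein_sol x y"
  using std_normal_cdf_range std_normal_density_pos[of y] by (simp add: stein_sol_def)

text \<open>By monotonicity of \<open>\<Phi>\<close> the two branches have the common bound \<open>\<Phi>(y) (1 - \<Phi>(y)) / \<phi>(y)\<close>, which
the Mills ratio controls on both sides of 0.\<close>

lemma stein_sol_le: "stein_sol x y \<le> \<Phi> y * (1 - \<Phi> y) / \<phi> y"
  unfolding stein_sol_def
  using std_normal_cdf_range[of y] std_normal_cdf_range[of x] std_normal_cdf_mono[of x y] std_normal_cdf_mono[of y x]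
    std_normal_density_pos[of y]
  by (intro divide_right_mono) (auto intro!: mult_mono)

lemma stein_sol_mult_bound: "\<bar>y * stein_sol x y\<bar> \<le> 1"
proof -
  have "\<bar>y\<bar> * (\<Phi> y * (1 - \<Phi> y)) \<le> \<phi> y"
  proof (cases y "0 :: real" rule: linorder_cases)
    case less
    have "(-y * \<Phi> y) * (1 - \<Phi> y) \<le> \<phi> y * 1"
      by (intro mult_mono mills_ratio_lower less)
         (use std_normal_cdf_range[of y] less std_normal_density_pos[of y] in auto)
    thus ?thesis using less by (simp add: mult.assoc)
  next
    case greater
    have "\<Phi> y * (y * (1 - \<Phi> y)) \<le> 1 * \<phi> y"
      by (intro mult_mono mills_ratio_upper greater)
         (use std_normal_cdf_range[of y] greater in auto)
    thus ?thesis using greater by (simp add: mult_ac)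
  qed (use std_normal_density_pos[of 0] in auto)
  hence "\<bar>y\<bar> * (\<Phi> y * (1 - \<Phi> y) / \<phi> y) \<le> 1"
    using std_normal_density_pos[of y] by (simp add: field_simps)
  moreover have "\<bar>y\<bar> * stein_sol x y \<le> \<bar>y\<bar> * (\<Phi> y * (1 - \<Phi> y) / \<phi> y)"
    by (intro mult_left_mono stein_sol_le) auto
  ultimately show ?thesis using stein_sol_nonneg[of x y] by (simp add: abs_mult)
qed

lemma stein_sol_bound: "stein_sol x y \<le> 6"
proof (cases "\<bar>y\<bar> \<ge> 1")
  case True
  have "1 * stein_sol x y \<le> \<bar>y\<bar> * stein_sol x y"
    by (intro mult_right_mono True stein_sol_nonneg)
  thus ?thesis using stein_sol_mult_bound[of y x] stein_sol_nonneg[of x y] by (simp add: abs_mult)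
next
  case False
  have "y\<^sup>2 \<le> 1\<^sup>2" using False by (intro power2_le_iff_abs_le[THEN iffD2]) auto
  hence "1 / 2 \<le> 1 + (- y\<^sup>2 / 2)" by simp
  also have "\<dots> \<le> exp (- y\<^sup>2 / 2)" by (rule exp_ge_add_one_self)
  finally have e: "1 / 2 \<le> exp (- y\<^sup>2 / 2)" .
  \<comment> \<open>On \<open>[-1, 1]\<close> the density is at least \<open>exp (-1/2) / sqrt (2 \<pi>) \<ge> (1/2) / 3\<close>; outside, the previous lemma applies.\<close>
  have s: "sqrt (2 * pi) \<le> 3" using pi_less_4 by (intro real_le_lsqrt) auto
  have "1 / 3 * (1 / 2) \<le> 1 / sqrt (2 * pi) * exp (- y\<^sup>2 / 2)"
    by (intro mult_mono e) (use s in \<open>auto simp: field_simps\<close>)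
  hence d: "1 / 6 \<le> \<phi> y" by (simp add: std_normal_density_def)
  have "\<Phi> y * (1 - \<Phi> y) \<le> 1" using std_normal_cdf_range[of y] by (intro mult_le_one) auto
  also have "1 \<le> 6 * \<phi> y" using d by simp
  finally have "\<Phi> y * (1 - \<Phi> y) / \<phi> y \<le> 6"
    using std_normal_density_pos[of y] by (simp add: field_simps)
  with stein_sol_le[of x y] show ?thesis by linarith
qed

lemma stein_sol_mvt_left:
  assumes "a < b" "b \<le> x"
  shows "\<exists>\<eta>\<in>{a..b}. stein_sol x b - stein_sol x a = (b - a) * (\<eta> * stein_sol x \<eta> + (1 - \<Phi> x))"
proof -
  let ?s = "\<lambda>y. \<Phi> y * (1 - \<Phi> x) / \<phi> y"
  have "(?s has_real_derivative y * ?s y + (1 - \<Phi> x)) (at y)" for y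
    using std_normal_density_pos[of y]
    by (auto intro!: derivative_eq_intros std_normal_density_deriv std_normal_cdf_deriv
          simp: field_simps power2_eq_square)
  from MVT2[OF assms(1), of ?s, OF this] obtain z where
    "z > a" "z < b" "?s b - ?s a = (b - a) * (z * ?s z + (1 - \<Phi> x))" by auto
  thus ?thesis using assms by (intro bexI[of _ z]) (auto simp: stein_sol_def)
qed

lemma stein_sol_mvt_right:
  assumes "a < b" "x \<le> a"
  shows "\<exists>\<eta>\<in>{a..b}. stein_sol x b - stein_sol x a = (b - a) * (\<eta> * stein_sol x \<eta> - \<Phi> x)"
proof -
  let ?s = "\<lambda>y. \<Phi> x * (1 - \<Phi> y) / \<phi> y"
  have eq: "stein_sol x y = ?s y" if "y \<ge> x" for y
    using that by (auto simp: stein_sol_def)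
  have "(?s has_real_derivative y * ?s y - \<Phi> x) (at y)" for y
    using std_normal_density_pos[of y]
    by (auto intro!: derivative_eq_intros std_normal_density_deriv std_normal_cdf_deriv
          simp: field_simps power2_eq_square)
  from MVT2[OF assms(1), of ?s, OF this] obtain z where
    "z > a" "z < b" "?s b - ?s a = (b - a) * (z * ?s z - \<Phi> x)" by auto
  thus ?thesis using assms by (intro bexI[of _ z]) (auto simp: eq)
qed

text \<open>An increment of the solution, by the mean value theorem and the Stein equation. If the kink \<open>x\<close> lies
inside the interval, the two sides of \<open>x\<close> are treated separately and averaged with weights
proportional to their lengths. The weight \<open>l\<close> is the fraction of \<open>[a, b]\<close> below \<open>x\<close>; it plays the role
of \<open>P(W\<^sup>* \<le> x)\<close> given that \<open>W\<^sup>*\<close> is uniform on \<open>[a, b]\<close>.\<close>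

lemma stein_sol_increment:
  assumes "a < b"
  obtains l r s where "0 \<le> l" "l \<le> 1" "b \<le> x \<Longrightarrow> l = 1" "x \<le> a \<Longrightarrow> l = 0" "r \<in> {a..b}" "s \<in> {a..b}"
    "stein_sol x b - stein_sol x a =
       (b - a) * (l - \<Phi> x + (l * (r * stein_sol x r) + (1 - l) * (s * stein_sol x s)))"
proof -
  consider "b \<le> x" | "x \<le> a" | "a < x" "x < b" by linarith
  thus ?thesis
  proof cases
    case 1
    from stein_sol_mvt_left[OF assms 1] obtain r where
      "r \<in> {a..b}" "stein_sol x b - stein_sol x a = (b - a) * (r * stein_sol x r + (1 - \<Phi> x))" ..
    thus ?thesis using 1 assms by (intro that[of 1 r r]) auto
  next
    case 2
    from stein_sol_mvt_right[OF assms 2] obtain r where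
      "r \<in> {a..b}" "stein_sol x b - stein_sol x a = (b - a) * (r * stein_sol x r - \<Phi> x)" ..
    thus ?thesis using 2 assms by (intro that[of 0 r r]) auto
  next
    case 3
    from stein_sol_mvt_left[OF 3(1), of x] obtain r where r: "r \<in> {a..x}"
      "stein_sol x x - stein_sol x a = (x - a) * (r * stein_sol x r + (1 - \<Phi> x))" by auto
    from stein_sol_mvt_right[OF 3(2), of x] obtain s where s: "s \<in> {x..b}"
      "stein_sol x b - stein_sol x x = (b - x) * (s * stein_sol x s - \<Phi> x)" by auto
    define l where "l = (x - a) / (b - a)"
    have l: "(b - a) * l = x - a" "(b - a) * (1 - l) = b - x" using assms by (auto simp: l_def field_simps)
    have "stein_sol x b - stein_sol x a =
      ((b - a) * l) * (r * stein_sol x r + (1 - \<Phi> x)) + ((b - a) * (1 - l)) * (s * stein_sol x s - \<Phi> x)"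
      unfolding l using r(2) s(2) by simp
    also have "\<dots> = (b - a) * (l - \<Phi> x + (l * (r * stein_sol x r) + (1 - l) * (s * stein_sol x s)))"
      by (simp add: algebra_simps)
    finally show ?thesis using r(1) s(1) 3 by (intro that[of l r s]) (auto simp: l_def)
  qed
qed

text \<open>By the Stein equation the derivative is \<open>y f(y)\<close> plus a term in \<open>[-1, 1]\<close>, and \<open>\<bar>y f(y)\<bar> \<le> 1\<close>.\<close>

lemma stein_sol_lipschitz: "\<bar>stein_sol x b - stein_sol x a\<bar> \<le> 2 * \<bar>b - a\<bar>"
proof -
  have *: "\<bar>stein_sol x b - stein_sol x a\<bar> \<le> 2 * (b - a)" if ab: "a < b" for a b
  proof -
    from stein_sol_increment[OF ab, of x] obtain l r s where l: "0 \<le> l" "l \<le> 1" and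
      eq: "stein_sol x b - stein_sol x a =
       (b - a) * (l - \<Phi> x + (l * (r * stein_sol x r) + (1 - l) * (s * stein_sol x s)))" by metis
    have "\<bar>l * (r * stein_sol x r) + (1 - l) * (s * stein_sol x s)\<bar>
        \<le> \<bar>l * (r * stein_sol x r)\<bar> + \<bar>(1 - l) * (s * stein_sol x s)\<bar>" by linarith
    also have "\<dots> = l * \<bar>r * stein_sol x r\<bar> + (1 - l) * \<bar>s * stein_sol x s\<bar>"
      using l by (simp add: abs_mult)
    also have "\<dots> \<le> l * 1 + (1 - l) * 1"
      by (intro add_mono mult_left_mono stein_sol_mult_bound) (use l in auto)
    finally have t: "\<bar>l * (r * stein_sol x r) + (1 - l) * (s * stein_sol x s)\<bar> \<le> 1" by simp
    have "\<bar>l - \<Phi> x\<bar> \<le> 1" using l std_normal_cdf_range[of x] by auto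
    with t have "\<bar>l - \<Phi> x + (l * (r * stein_sol x r) + (1 - l) * (s * stein_sol x s))\<bar> \<le> 2"
      by (smt (verit) abs_triangle_ineq)
    hence "(b - a) * \<bar>l - \<Phi> x + (l * (r * stein_sol x r) + (1 - l) * (s * stein_sol x s))\<bar> \<le> (b - a) * 2"
      using ab by (intro mult_left_mono) auto
    thus ?thesis unfolding eq using ab by (simp add: abs_mult mult.commute)
  qed
  show ?thesis using *[of a b] *[of b a] by (cases a b rule: linorder_cases) auto
qed

lemma stein_sol_mult_diff:
  "\<bar>u * stein_sol x u - v * stein_sol x v\<bar> \<le> \<bar>u - v\<bar> * (2 * \<bar>v\<bar> + 6)"
proof -
  have "u * stein_sol x u - v * stein_sol x v =
      v * (stein_sol x u - stein_sol x v) + (u - v) * stein_sol x u"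
    by (simp add: algebra_simps)
  also have "\<bar>\<dots>\<bar> \<le> \<bar>v\<bar> * \<bar>stein_sol x u - stein_sol x v\<bar> + \<bar>u - v\<bar> * \<bar>stein_sol x u\<bar>"
    by (metis abs_mult abs_triangle_ineq)
  also have "\<dots> \<le> \<bar>v\<bar> * (2 * \<bar>u - v\<bar>) + \<bar>u - v\<bar> * 6"
    by (intro add_mono mult_left_mono stein_sol_lipschitz)
       (use stein_sol_bound[of x u] stein_sol_nonneg[of x u] in auto)
  finally show ?thesis by (simp add: algebra_simps)
qed

text \<open>Apply the zero-bias identity to \<open>f(w\<^sub>k)\<close>, where \<open>f\<close> solves the Stein equation for a threshold \<open>y\<close> and
\<open>w\<^sub>k = (k - \<mu>) / \<sigma>\<close>. The increments of \<open>f\<close> split into a fraction \<open>l\<close>, the constant \<open>\<Phi>(y)\<close> and a value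
close to \<open>w f(w)\<close> at either end of the interval. Cancelling \<open>E W f(W)\<close> with the last part leaves
\<open>\<bar>P(W\<^sup>* \<le> y) - \<Phi>(y)\<bar> \<le> 8 / \<sigma>\<close>, and shifting the threshold by \<open>1 / \<sigma>\<close> costs one more \<open>1 / \<sigma>\<close> because
\<open>\<Phi>\<close> is 1-Lipschitz.\<close>

lemma berry_esseen_bernoulli:
  fixes ps :: "real list"
  defines "\<sigma> \<equiv> sqrt (bvar ps)"
  assumes ps: "is_probs ps" and pos: "bvar ps > 0"
  shows "\<bar>bexp ps (\<lambda>k. if (real k - bmean ps) / \<sigma> \<le> x then 1 else 0) - \<Phi> x\<bar> \<le> 9 / \<sigma>"
proof -
  define \<delta> where "\<delta> = 1 / \<sigma>"
  define w where "w k = (real k - bmean ps) / \<sigma>" for k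
  have \<sigma>: "\<sigma> > 0" "\<sigma>\<^sup>2 = bvar ps" using pos by (auto simp: \<sigma>_def)
  have \<delta>: "\<delta> > 0" using \<sigma> by (simp add: \<delta>_def)
  have wSuc: "w (Suc k) = w k + \<delta>" for k by (simp add: w_def \<delta>_def diff_divide_distrib add_divide_distrib)
  let ?I = "\<lambda>x k. if w k \<le> x then 1 else (0::real)"
  \<comment> \<open>The error of the coupling is \<open>\<delta> E (2 \<bar>W\<bar> + 6)\<close>, and \<open>2 \<bar>W\<bar> \<le> 1 + W\<^sup>2\<close> with \<open>E W\<^sup>2 = 1\<close>.\<close>
  have "bexp ps (\<lambda>k. 2 * \<bar>w k\<bar> + 6) \<le> bexp ps (\<lambda>k. (1 / \<sigma>\<^sup>2) * (real k - bmean ps)\<^sup>2 + 7)"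
  proof (rule bexp_mono[OF ps])
    fix k
    have "0 \<le> (\<bar>w k\<bar> - 1)\<^sup>2" by simp
    hence "2 * \<bar>w k\<bar> + 6 \<le> (w k)\<^sup>2 + 7" by (simp add: power2_diff)
    thus "2 * \<bar>w k\<bar> + 6 \<le> (1 / \<sigma>\<^sup>2) * (real k - bmean ps)\<^sup>2 + 7"
      by (simp add: w_def power_divide)
  qed
  also have "\<dots> = 8"
    unfolding bexp_add bexp_cmult bexp_variance using \<sigma> pos by simp
  finally have \<rho>: "bexp ps (\<lambda>k. 2 * \<bar>w k\<bar> + 6) \<le> 8" .

  have main: "bexp ps (?I (y - \<delta>)) \<le> \<Phi> y + 8 * \<delta> \<and> \<Phi> y - 8 * \<delta> \<le> bexp ps (?I (y + \<delta>))" for y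
  proof -
    let ?f = "stein_sol y"
    have "\<exists>l c. 0 \<le> l \<and> l \<le> 1 \<and> (w (Suc j) \<le> y \<longrightarrow> l = 1) \<and> (y \<le> w j \<longrightarrow> l = 0) \<and>
        ?f (w (Suc j)) - ?f (w j) = \<delta> * (l - \<Phi> y + c) \<and>
        (\<forall>v\<in>{w j, w (Suc j)}. \<bar>c - v * ?f v\<bar> \<le> \<delta> * (2 * \<bar>v\<bar> + 6))" for j
    proof -
      have "w j < w (Suc j)" using \<delta> by (simp add: wSuc)
      from stein_sol_increment[OF this, of y] obtain l r s where l: "0 \<le> l" "l \<le> 1"
         "w (Suc j) \<le> y \<Longrightarrow> l = 1" "y \<le> w j \<Longrightarrow> l = 0"
        and rs: "r \<in> {w j..w (Suc j)}" "s \<in> {w j..w (Suc j)}"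
        and eq: "?f (w (Suc j)) - ?f (w j) =
       (w (Suc j) - w j) * (l - \<Phi> y + (l * (r * ?f r) + (1 - l) * (s * ?f s)))" by metis
      have "\<bar>l * (r * ?f r) + (1 - l) * (s * ?f s) - v * ?f v\<bar> \<le> \<delta> * (2 * \<bar>v\<bar> + 6)"
        if v: "v \<in> {w j, w (Suc j)}" for v
      proof -
        have "l * (r * ?f r) + (1 - l) * (s * ?f s) - v * ?f v =
           l * (r * ?f r - v * ?f v) + (1 - l) * (s * ?f s - v * ?f v)" by (simp add: algebra_simps)
        also have "\<bar>\<dots>\<bar> \<le> \<bar>l * (r * ?f r - v * ?f v)\<bar> + \<bar>(1 - l) * (s * ?f s - v * ?f v)\<bar>"
          by (rule abs_triangle_ineq)
        also have "\<dots> = l * \<bar>r * ?f r - v * ?f v\<bar> + (1 - l) * \<bar>s * ?f s - v * ?f v\<bar>"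
          using l by (simp add: abs_mult)
        also have "\<dots> \<le> l * (\<bar>r - v\<bar> * (2 * \<bar>v\<bar> + 6)) + (1 - l) * (\<bar>s - v\<bar> * (2 * \<bar>v\<bar> + 6))"
          by (intro add_mono mult_left_mono stein_sol_mult_diff) (use l in auto)
        also have "\<dots> \<le> l * (\<delta> * (2 * \<bar>v\<bar> + 6)) + (1 - l) * (\<delta> * (2 * \<bar>v\<bar> + 6))"
          by (intro add_mono mult_left_mono mult_right_mono) (use l rs v wSuc[of j] in auto)
        finally show ?thesis by (simp add: algebra_simps)
      qed
      thus ?thesis using l eq wSuc[of j] by (intro exI[of _ l] exI[of _ "l * (r * ?f r) + (1 - l) * (s * ?f s)"]) auto
    qed
    then obtain l c where l: "\<And>j. 0 \<le> l j" "\<And>j. l j \<le> 1" "\<And>j. w (Suc j) \<le> y \<Longrightarrow> l j = 1"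
         "\<And>j. y \<le> w j \<Longrightarrow> l j = 0"
      and eq: "\<And>j. ?f (w (Suc j)) - ?f (w j) = \<delta> * (l j - \<Phi> y + c j)"
      and c: "\<And>j v. v \<in> {w j, w (Suc j)} \<Longrightarrow> \<bar>c j - v * ?f v\<bar> \<le> \<delta> * (2 * \<bar>v\<bar> + 6)"
      by metis
    have "\<sigma> * bexp ps (\<lambda>k. w k * ?f (w k)) = bexp ps (\<lambda>k. (real k - bmean ps) * ?f (w k))"
      using \<sigma> by (simp add: bexp_cmult[symmetric] w_def)
    also have "\<dots> = zbias ps (\<lambda>k. \<delta> * (l k - \<Phi> y + c k))"
      unfolding zbias_characterization eq ..
    also have "\<dots> = \<delta> * (zbias ps l - \<Phi> y * \<sigma>\<^sup>2 + zbias ps c)"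
      unfolding zbias_cmult zbias_add zbias_diff zbias_const \<sigma> ..
    finally have E1: "\<sigma>\<^sup>2 * bexp ps (\<lambda>k. w k * ?f (w k)) = zbias ps l - \<Phi> y * \<sigma>\<^sup>2 + zbias ps c"
      using \<sigma>(1) by (simp add: \<delta>_def field_simps power2_eq_square)
    \<comment> \<open>The coupling, applied to \<open>w f(w)\<close> from below and from above.\<close>
    have "bvar ps * bexp ps (\<lambda>k. w k * ?f (w k) - \<delta> * (2 * \<bar>w k\<bar> + 6)) \<le> zbias ps c"
    proof (intro zbias_coupling ps)
      fix j show "w j * ?f (w j) - \<delta> * (2 * \<bar>w j\<bar> + 6) \<le> c j" using c[of "w j" j] by force
      show "w (Suc j) * ?f (w (Suc j)) - \<delta> * (2 * \<bar>w (Suc j)\<bar> + 6) \<le> c j" using c[of "w (Suc j)" j] by force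
    qed
    hence E2: "\<sigma>\<^sup>2 * bexp ps (\<lambda>k. w k * ?f (w k)) - \<sigma>\<^sup>2 * (\<delta> * bexp ps (\<lambda>k. 2 * \<bar>w k\<bar> + 6)) \<le> zbias ps c"
      unfolding \<sigma> bexp_diff bexp_cmult by (simp add: algebra_simps)
    have "bvar ps * bexp ps (\<lambda>k. (-1) * (w k * ?f (w k)) - \<delta> * (2 * \<bar>w k\<bar> + 6)) \<le> zbias ps (\<lambda>j. (-1) * c j)"
    proof (intro zbias_coupling ps)
      fix j show "(-1) * (w j * ?f (w j)) - \<delta> * (2 * \<bar>w j\<bar> + 6) \<le> (-1) * c j" using c[of "w j" j] by force
      show "(-1) * (w (Suc j) * ?f (w (Suc j))) - \<delta> * (2 * \<bar>w (Suc j)\<bar> + 6) \<le> (-1) * c j" using c[of "w (Suc j)" j] by force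
    qed
    hence E3: "zbias ps c \<le> \<sigma>\<^sup>2 * bexp ps (\<lambda>k. w k * ?f (w k)) + \<sigma>\<^sup>2 * (\<delta> * bexp ps (\<lambda>k. 2 * \<bar>w k\<bar> + 6))"
      unfolding \<sigma> bexp_diff bexp_cmult zbias_cmult by (simp add: algebra_simps)
    have E4: "\<sigma>\<^sup>2 * (\<delta> * bexp ps (\<lambda>k. 2 * \<bar>w k\<bar> + 6)) \<le> \<sigma>\<^sup>2 * (\<delta> * 8)"
      by (intro mult_left_mono \<rho>) (use \<delta> in auto)
    \<comment> \<open>The coupling, applied to the indicators of the shifted thresholds: \<open>l\<close> is 1 if both ends of the interval are below \<open>y\<close>, and 0 if both are above.\<close>
    have E5: "bvar ps * bexp ps (?I (y - \<delta>)) \<le> zbias ps l"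
      by (intro zbias_coupling ps) (use l \<delta> wSuc in \<open>auto\<close>)
    have "bvar ps * bexp ps (\<lambda>k. (-1) * ?I (y + \<delta>) k) \<le> zbias ps (\<lambda>k. (-1) * l k)"
    proof (intro zbias_coupling ps)
      fix j
      show "-1 * ?I (y + \<delta>) j \<le> -1 * l j" using l(2)[of j] l(4)[of j] \<delta> by auto
      show "-1 * ?I (y + \<delta>) (Suc j) \<le> -1 * l j" using l(2)[of j] l(4)[of j] \<delta> by (auto simp: wSuc)
    qed
    hence E6: "zbias ps l \<le> bvar ps * bexp ps (?I (y + \<delta>))"
      unfolding bexp_cmult zbias_cmult by simp
    have "\<sigma>\<^sup>2 * bexp ps (?I (y - \<delta>)) \<le> \<sigma>\<^sup>2 * (\<Phi> y + 8 * \<delta>)"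
      using E1 E2 E4 E5 \<sigma>(2) by (simp add: algebra_simps)
    moreover have "\<sigma>\<^sup>2 * (\<Phi> y - 8 * \<delta>) \<le> \<sigma>\<^sup>2 * bexp ps (?I (y + \<delta>))"
      using E1 E3 E4 E6 \<sigma>(2) by (simp add: algebra_simps)
    ultimately show ?thesis using \<sigma> pos by (simp add: mult_le_cancel_left)
  qed
  have "bexp ps (?I x) \<le> \<Phi> x + 9 * \<delta>"
    using main[of "x + \<delta>"] std_normal_cdf_lipschitz[of \<delta> x] \<delta> by auto
  moreover have "\<Phi> x - 9 * \<delta> \<le> bexp ps (?I x)"
    using main[of "x - \<delta>"] std_normal_cdf_lipschitz[of \<delta> "x - \<delta>"] \<delta> by auto
  ultimately show ?thesis unfolding w_def[symmetric] by (auto simp: \<delta>_def abs_le_iff)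
qed

section \<open>The generating polynomials of the chain\<close>

text \<open>The renewal equation, solved for \<open>G\<^sub>n\<close>. The coefficient domain is polymorphic because the zeros are
studied over the complex numbers, whereas probabilities are real.\<close>

fun chain_poly :: "nat \<Rightarrow> 'a :: field_char_0 poly" where
  "chain_poly n = (if n = 0 then 1 else
     smult (2 / (of_nat n * of_nat (Suc n))) ([:0, 1:] * (\<Sum>m<n. smult (of_nat (n - m)) (chain_poly m))))"

declare chain_poly.simps [simp del]

lemma chain_poly_0 [simp]: "chain_poly 0 = 1"
  by (subst chain_poly.simps) simp

lemma chain_poly_renewal:
  assumes "n > 0"
  shows "smult (of_nat n * of_nat (Suc n)) (chain_poly n :: 'a :: field_char_0 poly) =
     [:0, 2:] * (\<Sum>m<n. smult (of_nat (n - m)) (chain_poly m))"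
proof -
  have "smult (of_nat n * of_nat (Suc n)) (chain_poly n :: 'a poly) =
     smult 2 ([:0, 1:] * (\<Sum>m<n. smult (of_nat (n - m)) (chain_poly m)))"
    using assms of_nat_eq_0_iff[of "Suc n", where ?'a = 'a] 
    by (subst chain_poly.simps) (simp del: of_nat_Suc)
  also have "\<dots> = smult 2 [:0, 1:] * (\<Sum>m<n. smult (of_nat (n - m)) (chain_poly m))"
    by (simp only: mult_smult_left)
  finally show ?thesis by simp
qed

lemma chain_poly_1 [simp]: "chain_poly (Suc 0) = [:0, 1:]"
  by (subst chain_poly.simps) (simp add: lessThan_Suc)

text \<open>Twice differencing the weights \<open>n - m\<close> in the renewal equation leaves only the last summand.\<close>

lemma chain_poly_three_term:
  "smult (of_nat ((n + 1) * (n + 2))) (chain_poly (n + 1)) =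
     [:of_nat (2 * n * (n + 1)), 2:] * chain_poly n - smult (of_nat (n * (n - 1))) (chain_poly (n - 1) :: 'a :: field_char_0 poly)"
proof (cases "n = 0")
  case False
  then obtain k where n: "n = Suc k" by (cases n) auto
  let ?S = "\<lambda>n. (\<Sum>m<n. smult (of_nat (n - m)) (chain_poly m)) :: 'a poly"
  let ?T = "\<lambda>n. (\<Sum>m<n. chain_poly m) :: 'a poly"
  have S: "?S (Suc j) = ?S j + ?T (Suc j)" for j
  proof -
    have "(\<Sum>m<j. smult (of_nat (Suc j - m)) (chain_poly m) :: 'a poly) =
      (\<Sum>m<j. smult (of_nat (j - m)) (chain_poly m) + chain_poly m)"
      by (intro sum.cong refl) (simp add: Suc_diff_le smult_add_left)
    thus ?thesis by (simp add: sum.distrib)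
  qed
  have R: "smult (of_nat j * of_nat (Suc j)) (chain_poly j) = [:0, 2:] * ?S j" for j
  proof (cases "j = 0")
    case False
    thus ?thesis using chain_poly_renewal[of j] by blast
  qed simp
  have "smult (of_nat ((n + 1) * (n + 2))) (chain_poly (n + 1)) + smult (of_nat (n * (n - 1))) (chain_poly (n - 1))
     = [:0, 2:] * (?S (Suc (Suc k)) + ?S k :: 'a poly)"
    using R[of "Suc (Suc k)"] R[of k] unfolding n
    by (simp only: distrib_left) (simp add: algebra_simps)
  also have "\<dots> = [:0, 2:] * (2 * ?S (Suc k) + chain_poly (Suc k))"
    by (simp only: S) (simp add: algebra_simps smult_add_right)
  also have "\<dots> = smult 2 ([:0, 2:] * ?S (Suc k)) + [:0, 2:] * chain_poly (Suc k)"
    by (simp only: numeral_poly distrib_left mult_smult_right mult_smult_left mult_ac) simp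
  also have "\<dots> = [:of_nat (2 * n * (n + 1)), 2:] * chain_poly n"
    unfolding R[symmetric] n by (simp add: smult_add_left smult_add_right algebra_simps)
  finally show ?thesis by (simp add: algebra_simps)
qed auto

lemma poly_chain_poly_three_term:
  "of_nat ((n + 1) * (n + 2)) * poly (chain_poly (n + 1)) z =
     (of_nat (2 * n * (n + 1)) + 2 * z) * poly (chain_poly n) z
     - of_nat (n * (n - 1)) * poly (chain_poly (n - 1)) (z :: 'a :: field_char_0)"
  using arg_cong[OF chain_poly_three_term[of n], of "\<lambda>p. poly p z"]
  by (simp add: algebra_simps)

lemma poly_chain_poly_renewal:
  fixes z :: "'a :: field_char_0"
  assumes "n > 0"
  shows "poly (chain_poly n) z =
     2 * z / (of_nat n * of_nat (Suc n)) * (\<Sum>m<n. of_nat (n - m) * poly (chain_poly m) z)"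
  using assms by (subst chain_poly.simps) (simp add: poly_sum)

lemma chain_poly_of_real: "poly (chain_poly n) (of_real x :: complex) = of_real (poly (chain_poly n) x)"
proof (induction n rule: less_induct)
  case (less n)
  show ?case
    by (cases "n = 0") (simp_all add: poly_chain_poly_renewal less)
qed

lemma chain_poly_pos:
  assumes "x > 0"
  shows "poly (chain_poly n) x > (0 :: real)"
proof (induction n rule: less_induct)
  case (less n)
  show ?case
  proof (cases "n = 0")
    case False
    have "0 < (\<Sum>m<n. of_nat (n - m) * poly (chain_poly m) x)"
      using False by (intro sum_pos mult_pos_pos less) auto
    thus ?thesis using False assms by (simp add: poly_chain_poly_renewal)
  qed auto
qed

lemma chain_poly_at_1 [simp]: "poly (chain_poly n) 1 = (1 :: real)"
proof (induction n rule: less_induct)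
  case (less n)
  show ?case
  proof (cases "n = 0")
    case False
    have "(\<Sum>m<n. real (n - m) * poly (chain_poly m) 1) = (\<Sum>m<n. real (n - m))"
      by (intro sum.cong) (auto simp: less)
    also have "\<dots> = (\<Sum>m<n. real (Suc m))"
      by (rule sum.reindex_bij_witness[of _ "\<lambda>m. n - Suc m" "\<lambda>m. n - Suc m"]) auto
    also have "\<dots> = real n * real (Suc n) / 2"
      by (induction n) (auto simp: field_simps)
    finally show ?thesis using False by (simp add: poly_chain_poly_renewal del: of_nat_Suc)
  qed auto
qed

text \<open>Christoffel-Darboux: multiply the recurrence by the conjugate of \<open>G\<^sub>n(z)\<close> and take imaginary parts. The
quantity \<open>Im z \<cdot> Im (G\<^sub>n\<^sub>+\<^sub>1(z) cnj (G\<^sub>n(z)))\<close> then satisfies a recurrence with nonnegative coefficients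
and the additional term \<open>2 (Im z)\<^sup>2 \<bar>G\<^sub>n(z)\<bar>\<^sup>2\<close>. Hence it stays positive once it is, which happens for
\<open>n = 1\<close>, and \<open>G\<^sub>n\<^sub>+\<^sub>1(z)\<close> cannot vanish.\<close>

lemma chain_poly_nonreal_root_free:
  assumes "Im z \<noteq> 0"
  shows "poly (chain_poly n) z \<noteq> 0"
proof -
  let ?P = "\<lambda>n. poly (chain_poly n) z"
  have pos: "0 < Im z * Im (?P (Suc n + 1) * cnj (?P (Suc n)))" for n
  proof (induction n)
    case 0
    have "6 * ?P 2 = 4 * z + 2 * z * z"
      using poly_chain_poly_three_term[of 1 z] by (simp add: algebra_simps numeral_2_eq_2)
    hence "6 * ?P 2 * cnj z = 4 * (z * cnj z) + 2 * z * (z * cnj z)" by (simp add: algebra_simps)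
    hence "Im (6 * ?P 2 * cnj z) = 2 * Im z * (cmod z)\<^sup>2"
      by (simp only: complex_norm_square[symmetric] flip: power2_eq_square) simp
    hence "6 * Im (?P 2 * cnj z) = 2 * Im z * (cmod z)\<^sup>2" by simp
    hence "6 * (Im z * Im (?P 2 * cnj z)) = 2 * (Im z)\<^sup>2 * (cmod z)\<^sup>2"
      by (simp add: power2_eq_square algebra_simps)
    moreover have "0 < 2 * (Im z)\<^sup>2 * (cmod z)\<^sup>2" using assms by (intro mult_pos_pos) auto
    ultimately have p: "0 < 6 * (Im z * Im (?P 2 * cnj z))" by (simp only:)
    show ?case using zero_less_mult_pos[OF p] by (simp add: numeral_2_eq_2)
  next
    case (Suc n)
    have scale: "a * (s * x) = 2 * s\<^sup>2 * c + b * (s * y)" if "a * x = 2 * s * c - b * (- y)"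
      for a b c s x y :: real
    proof -
      have "a * (s * x) = s * (a * x)" by simp
      also have "\<dots> = 2 * s\<^sup>2 * c + b * (s * y)"
        unfolding that by (simp add: power2_eq_square algebra_simps)
      finally show ?thesis .
    qed
    define N where "N = Suc (Suc n)"
    have "of_nat ((N + 1) * (N + 2)) * ?P (N + 1) * cnj (?P N) =
      of_nat (2 * N * (N + 1)) * (?P N * cnj (?P N)) + 2 * z * (?P N * cnj (?P N))
      - of_nat (N * (N - 1)) * (?P (N - 1) * cnj (?P N))"
      unfolding poly_chain_poly_three_term by (simp add: algebra_simps)
    hence "Im (of_nat ((N + 1) * (N + 2)) * (?P (N + 1) * cnj (?P N))) =
      Im (of_nat (2 * N * (N + 1)) * of_real ((cmod (?P N))\<^sup>2) + 2 * z * of_real ((cmod (?P N))\<^sup>2)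
      - of_nat (N * (N - 1)) * (?P (N - 1) * cnj (?P N)))"
      by (simp only: complex_norm_square[symmetric] mult.assoc)
    hence "real ((N + 1) * (N + 2)) * Im (?P (N + 1) * cnj (?P N)) =
      2 * Im z * (cmod (?P N))\<^sup>2 - real (N * (N - 1)) * Im (?P (N - 1) * cnj (?P N))"
      by (simp add: of_nat_mult del: of_nat_add of_nat_Suc mult_Suc mult_Suc_right)
    also have "Im (?P (N - 1) * cnj (?P N)) = - Im (?P N * cnj (?P (N - 1)))"
      by simp
    finally have "real ((N + 1) * (N + 2)) * (Im z * Im (?P (N + 1) * cnj (?P N))) =
      2 * (Im z)\<^sup>2 * (cmod (?P N))\<^sup>2 + real (N * (N - 1)) * (Im z * Im (?P N * cnj (?P (N - 1))))"
      by (rule scale)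
    moreover have "0 < real (N * (N - 1)) * (Im z * Im (?P N * cnj (?P (N - 1))))"
    proof (rule mult_pos_pos)
      show "0 < Im z * Im (?P N * cnj (?P (N - 1)))" using Suc.IH by (simp add: N_def)
      show "0 < real (N * (N - 1))" by (simp only: of_nat_0_less_iff) (simp add: N_def)
    qed
    ultimately have "0 < real ((N + 1) * (N + 2)) * (Im z * Im (?P (N + 1) * cnj (?P N)))"
      by (smt (verit) mult_nonneg_nonneg zero_le_power2)
    moreover have "0 < real ((N + 1) * (N + 2))" by (simp only: of_nat_0_less_iff) simp
    ultimately show ?case unfolding N_def[symmetric] by (rule zero_less_mult_pos)
  qed
  consider "n = 0" | "n = 1" | k where "n = Suc k + 1"
    by (metis One_nat_def add.commute not0_implies_Suc plus_1_eq_Suc)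
  thus ?thesis
  proof cases
    case 2
    thus ?thesis using assms by auto
  next
    case (3 k)
    thus ?thesis using pos[of k] by auto
  qed auto
qed

text \<open>The generating polynomial of a sum of Bernoulli variables.\<close>

definition bernoulli_poly :: "real list \<Rightarrow> real poly" where
  "bernoulli_poly ps = (\<Prod>p\<leftarrow>ps. [:1 - p, p:])"

lemma bernoulli_poly_simps [simp]:
  "bernoulli_poly [] = 1" "bernoulli_poly (p # ps) = [:1 - p, p:] * bernoulli_poly ps"
  by (simp_all add: bernoulli_poly_def)

lemma bernoulli_poly_at_1 [simp]: "poly (bernoulli_poly ps) 1 = 1"
  by (induction ps) auto

lemma pderiv_linear_mult: "pderiv ([:a, b:] * q) = smult b q + [:a, b:] * pderiv q"
  by (simp only: pderiv_mult) (simp add: pderiv_pCons add_ac)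

lemma bernoulli_poly_pderiv_at_1: "poly (pderiv (bernoulli_poly ps)) 1 = bmean ps"
  by (induction ps) (auto simp: pderiv_linear_mult simp del: mult_pCons_left)

text \<open>The second factorial moment \<open>E S (S - 1) = \<sigma>\<^sup>2 + \<mu>\<^sup>2 - \<mu>\<close>.\<close>

lemma bernoulli_poly_pderiv2_at_1:
  "poly (pderiv (pderiv (bernoulli_poly ps))) 1 = (bmean ps)\<^sup>2 - bmean ps + bvar ps"
  by (induction ps) (auto simp: pderiv_linear_mult pderiv_add pderiv_smult bernoulli_poly_pderiv_at_1
       power2_eq_square left_diff_distrib right_diff_distrib distrib_left distrib_right simp del: mult_pCons_left)

text \<open>The zeros are real by the previous argument and not positive because the polynomial is positive on
\<open>(0, \<infinity>)\<close>. A zero \<open>x \<le> 0\<close> contributes, after normalisation at \<open>z = 1\<close>, the factor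
\<open>(z - x) / (1 - x) = 1 - p + p z\<close> with \<open>p = 1 / (1 - x)\<close>.\<close>

lemma chain_poly_bernoulli:
  obtains ps where "is_probs ps" "chain_poly n = bernoulli_poly ps"
proof -
  have nz: "(chain_poly n :: complex poly) \<noteq> 0"
    using chain_poly_nonreal_root_free[of \<i> n] by auto
  from alg_closed_imp_factorization[OF this] obtain A where
    A: "chain_poly n = smult (lead_coeff (chain_poly n)) (\<Prod>x\<in>#A. [:-x, 1 :: complex:])" by blast
  obtain xs where xs: "mset xs = A" using ex_mset by blast
  define c :: complex where "c = lead_coeff (chain_poly n)"
  have ev: "poly (chain_poly n) z = c * (\<Prod>x\<leftarrow>xs. z - x)" for z
  proof -
    have "poly (\<Prod>x\<leftarrow>xs. [:-x, 1 :: complex:]) z = (\<Prod>x\<leftarrow>xs. z - x)"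
      by (induction xs) (auto simp: algebra_simps)
    thus ?thesis
      by (subst A) (simp add: c_def xs[symmetric] prod_mset_prod_list flip: mset_map)
  qed
  have root: "Im x = 0 \<and> Re x \<le> 0" if x: "x \<in> set xs" for x
  proof -
    have "(\<Prod>y\<leftarrow>xs. x - y) = 0" using x by (auto simp: prod_list_zero_iff)
    hence 0: "poly (chain_poly n) x = 0" by (simp add: ev)
    hence im: "Im x = 0" using chain_poly_nonreal_root_free by blast
    hence "x = of_real (Re x)" by (simp add: complex_eq_iff)
    hence "poly (chain_poly n) (Re x) = 0" using 0 chain_poly_of_real[of n "Re x"] by simp
    thus ?thesis using im chain_poly_pos[of "Re x" n] by force
  qed
  define ps where "ps = map (\<lambda>x. 1 / (1 - Re x)) xs"
  have "0 \<le> 1 / (1 - Re x) \<and> 1 / (1 - Re x) \<le> 1" if "x \<in> set xs" for x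
    using root[OF that] by (auto simp: field_simps)
  hence "is_probs ps" by (auto simp: ps_def)
  moreover have "chain_poly n = bernoulli_poly ps"
  proof (rule poly_ext)
    fix t :: real
    have r: "complex_of_real (poly (chain_poly n) t) = c * of_real (\<Prod>x\<leftarrow>xs. t - Re x)" for t
    proof -
      have "(\<Prod>x\<leftarrow>xs. of_real t - x) = of_real (\<Prod>x\<leftarrow>xs. t - Re x)"
        using root by (induction xs) (auto simp: complex_eq_iff)
      thus ?thesis using ev[of "of_real t"] by (simp add: chain_poly_of_real)
    qed
    from r[of 1] have "1 = c * of_real (\<Prod>x\<leftarrow>xs. 1 - Re x)" by simp
    hence c: "c = 1 / of_real (\<Prod>x\<leftarrow>xs. 1 - Re x)"
      by (metis mult_zero_right nonzero_eq_divide_eq zero_neq_one)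
    have "complex_of_real (poly (chain_poly n) t) = of_real ((\<Prod>x\<leftarrow>xs. t - Re x) / (\<Prod>x\<leftarrow>xs. 1 - Re x))"
      unfolding r[of t] c by simp
    hence "poly (chain_poly n) t = (\<Prod>x\<leftarrow>xs. t - Re x) / (\<Prod>x\<leftarrow>xs. 1 - Re x)"
      by (simp only: of_real_eq_iff)
    also have "\<dots> = (\<Prod>x\<leftarrow>xs. (t - Re x) / (1 - Re x))"
      by (induction xs) (auto simp flip: times_divide_times_eq)
    also have "\<dots> = poly (bernoulli_poly ps) t"
      using root unfolding ps_def
    proof (induction xs)
      case (Cons x xs)
      have "(t - Re x) / (1 - Re x) = 1 - 1 / (1 - Re x) + t * (1 / (1 - Re x))"
      proof -
        have "1 - Re x > 0" using Cons.prems[of x] by simp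
        thus ?thesis by (simp add: divide_simps)
      qed
      note eq = this
      have "poly (bernoulli_poly (p # ps)) t = (1 - p + t * p) * poly (bernoulli_poly ps) t" for p ps
        by (simp add: algebra_simps)
      thus ?case using Cons by (simp add: eq del: bernoulli_poly_simps)
    qed auto
    finally show "poly (chain_poly n) t = poly (bernoulli_poly ps) t" .
  qed
  ultimately show ?thesis by (rule that)
qed

section \<open>Growth of the variance\<close>

definition chain_mean :: "nat \<Rightarrow> real" where
  "chain_mean n = poly (pderiv (chain_poly n)) 1"
definition chain_var :: "nat \<Rightarrow> real" where
  "chain_var n = poly (pderiv (pderiv (chain_poly n))) 1 + chain_mean n - (chain_mean n)\<^sup>2"

lemma chain_mean_rec:
  "real ((n + 1) * (n + 2)) * chain_mean (n + 1) =
     (real (2 * n * (n + 1)) + 2) * chain_mean n + 2 - real (n * (n - 1)) * chain_mean (n - 1)"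
  using arg_cong[OF chain_poly_three_term[of n], of "\<lambda>p. poly (pderiv p) (1 :: real)"]
  unfolding chain_mean_def pderiv_smult pderiv_diff pderiv_linear_mult
  by (simp add: algebra_simps)

lemma chain_snd_rec:
  "real ((n + 1) * (n + 2)) * poly (pderiv (pderiv (chain_poly (n + 1)))) 1 =
     (real (2 * n * (n + 1)) + 2) * poly (pderiv (pderiv (chain_poly n))) 1 + 4 * chain_mean n
     - real (n * (n - 1)) * poly (pderiv (pderiv (chain_poly (n - 1)))) 1"
  using arg_cong[OF chain_poly_three_term[of n], of "\<lambda>p. poly (pderiv (pderiv p)) (1 :: real)"]
  unfolding chain_mean_def pderiv_smult pderiv_diff pderiv_add pderiv_linear_mult
  by (simp add: algebra_simps)

text \<open>With \<open>d\<^sub>n\<close> the increment, the recurrence reads \<open>(n + 1) (n + 2) d\<^sub>n = n (n - 1) d\<^sub>n\<^sub>-\<^sub>1 + 2\<close>, since its coefficients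
sum to 0. The closed form fails for \<open>n = 0\<close>, where the increment is 1.\<close>

lemma chain_mean_increment:
  assumes "n \<ge> 1"
  shows "chain_mean (n + 1) - chain_mean n = 2 / (3 * real (n + 1))"
  using assms
proof (induction n rule: nat_induct_at_least)
  case base
  show ?case using chain_mean_rec[of 1] by (simp add: chain_mean_def pderiv_pCons)
next
  case (Suc n)
  have eq: "chain_mean n = chain_mean (Suc n) - 2 / (3 * real (n + 1))" using Suc.IH by simp
  have "real (n + 2) * (real (n + 3) * (chain_mean (Suc n + 1) - chain_mean (Suc n))) = 2 + real (n + 1) * real n * (2 / (3 * real (n + 1)))"
    using chain_mean_rec[of "Suc n"] by (simp add: eq algebra_simps)
  hence "real (n + 3) * (real (n + 2) * (chain_mean (Suc n + 1) - chain_mean (Suc n))) = 2 + real (n + 1) * real n * (2 / (3 * real (n + 1)))"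
    by (simp only: mult.left_commute)
  also have "\<dots> = real (n + 3) * (2 / 3)" by (simp add: field_simps)
  finally have "real (n + 2) * (chain_mean (Suc n + 1) - chain_mean (Suc n)) = 2 / 3" by (simp only: mult_cancel_left) simp
  thus ?case by (simp add: field_simps)
qed

text \<open>The effect of the recurrences on \<open>E N (N - 1) + E N - (E N)\<^sup>2\<close>: the contributions linear in the mean \<open>m\<close>
cancel, and only the squares of the two increments \<open>d\<close>, \<open>e\<close> of the mean survive. Here \<open>c\<^sub>1\<close>, \<open>c\<^sub>0\<close> are the
coefficients of the recurrence.\<close>

lemma variance_second_difference:
  fixes c0 c1 m d e b0 b1 b2 :: real
  assumes "c1 * (m + d - m) - c0 * (m - (m - e)) = 2" "c1 * (b2 - b1) - c0 * (b1 - b0) = 4 * m"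
  shows "c1 * ((b2 + (m + d) - (m + d)\<^sup>2) - (b1 + m - m\<^sup>2)) -
     c0 * ((b1 + m - m\<^sup>2) - (b0 + (m - e) - (m - e)\<^sup>2)) = 2 - c1 * d\<^sup>2 - c0 * e\<^sup>2"
proof -
  have "c1 * ((b2 + (m + d) - (m + d)\<^sup>2) - (b1 + m - m\<^sup>2)) -
     c0 * ((b1 + m - m\<^sup>2) - (b0 + (m - e) - (m - e)\<^sup>2)) =
     (c1 * (b2 - b1) - c0 * (b1 - b0)) + (1 - 2 * m) * (c1 * (m + d - m) - c0 * (m - (m - e)))
     - c1 * d\<^sup>2 - c0 * e\<^sup>2"
    by (simp add: power2_eq_square algebra_simps)
  thus ?thesis using assms by simp
qed

text \<open>For \<open>n \<ge> 2\<close> the increments \<open>D\<^sub>n\<close> of the variance satisfy \<open>(n + 1) (n + 2) D\<^sub>n \<ge> n (n - 1) D\<^sub>n\<^sub>-\<^sub>1 + 10 / 9\<close>, because the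
squared increments of the mean subtract at most \<open>8 / 9\<close> from the 2 on the right-hand side. The claimed
bound reproduces itself: \<open>10 (n - 1) / 27 + 10 / 9 = 10 (n + 2) / 27\<close>.\<close>

lemma chain_var_increment:
  assumes "n \<ge> 1"
  shows "chain_var (n + 1) - chain_var n \<ge> 10 / 27 / real (n + 1)"
  using assms
proof (induction n rule: nat_induct_at_least)
  case base
  have m1: "chain_mean 1 = 1" by (simp add: chain_mean_def pderiv_pCons)
  have b1: "poly (pderiv (pderiv (chain_poly 1))) (1 :: real) = 0" by (simp add: pderiv_pCons)
  have m2: "chain_mean (1 + 1) = 4 / 3" using chain_mean_rec[of 1] m1 by simp
  have b2: "poly (pderiv (pderiv (chain_poly (1 + 1)))) (1 :: real) = 2 / 3"
    using chain_snd_rec[of 1] m1 b1 by simp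
  show ?case unfolding chain_var_def b1 b2 m1 m2 by (simp add: power2_eq_square)
next
  case (Suc n)
  define d where "d = 2 / (3 * real (n + 2))"
  define e where "e = 2 / (3 * real (n + 1))"
  have m1: "chain_mean (n + 2) = chain_mean (n + 1) + d"
    using chain_mean_increment[of "Suc n"] by (simp add: d_def)
  have m0: "chain_mean n = chain_mean (n + 1) - e"
    using chain_mean_increment[of "n"] Suc by (simp add: e_def)
  have R: "real (n + 2) * real (n + 3) * (chain_mean (n + 2) - chain_mean (n + 1)) -
     real (n + 1) * real n * (chain_mean (n + 1) - chain_mean n) = 2"
    using chain_mean_rec[of "Suc n"] by (simp add: algebra_simps)
  let ?b = "\<lambda>n. poly (pderiv (pderiv (chain_poly n))) (1::real)"
  have "real (n + 2) * real (n + 3) * (?b (n + 2) - ?b (n + 1)) -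
     real (n + 1) * real n * (?b (n + 1) - ?b n) = 4 * chain_mean (n + 1)"
    using chain_snd_rec[of "Suc n"] by (simp add: algebra_simps)
  hence "real (n + 2) * real (n + 3) * (chain_var (n + 2) - chain_var (n + 1)) -
     real (n + 1) * real n * (chain_var (n + 1) - chain_var n) =
     2 - real (n + 2) * real (n + 3) * d\<^sup>2 - real (n + 1) * real n * e\<^sup>2"
    using R unfolding chain_var_def m1 m0 by (intro variance_second_difference) simp_all
  moreover have "real (n + 2) * real (n + 3) * d\<^sup>2 + real (n + 1) * real n * e\<^sup>2 \<le> 8 / 9"
  proof -
    have "x * (x + 1) * (2 / (3 * x))\<^sup>2 = 4 / 9 * (1 + 1 / x)" if "x > 0" for x :: real
      using that by (simp add: field_simps power2_eq_square)
    from this[of "real (n + 2)"] have 1: "real (n + 2) * real (n + 3) * d\<^sup>2 = 4 / 9 * (1 + 1 / real (n + 2))"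
      by (simp add: d_def add_ac)
    have "x * (x - 1) * (2 / (3 * x))\<^sup>2 = 4 / 9 * (1 - 1 / x)" if "x > 0" for x :: real
      using that by (simp add: field_simps power2_eq_square)
    from this[of "real (n + 1)"] have 2: "real (n + 1) * real n * e\<^sup>2 = 4 / 9 * (1 - 1 / real (n + 1))"
      by (simp add: e_def add_ac)
    have 3: "4 / 9 * (1 + a) + 4 / 9 * (1 - b) \<le> 8 / 9" if "a \<le> b" for a b :: real
    proof -
      have "4 / 9 * (1 + a) + 4 / 9 * (1 - b) = 8 / 9 + 4 / 9 * (a - b)"
        by (simp add: algebra_simps add_divide_distrib diff_divide_distrib)
      moreover have "4 / 9 * (a - b) \<le> 0" using that by (intro mult_nonneg_nonpos) auto
      ultimately show ?thesis by linarith
    qed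
    show ?thesis unfolding 1 2 by (intro 3 divide_left_mono) auto
  qed
  moreover have "real (n + 1) * real n * (chain_var (n + 1) - chain_var n) \<ge> real (n + 1) * real n * (10 / 27 / real (n + 1))"
    by (intro mult_left_mono Suc.IH) auto
  moreover have "real (n + 1) * real n * (10 / 27 / real (n + 1)) = real n * (10 / 27)"
  proof -
    have "x * y * (10 / 27 / x) = y * (10 / 27)" if "x \<noteq> 0" for x y :: real using that by simp
    thus ?thesis by (metis of_nat_eq_0_iff add_is_0 one_neq_zero)
  qed
  moreover have "real n * (10 / 27) + 10 / 9 = real (n + 3) * (10 / 27)" by simp
  ultimately have "real (n + 2) * real (n + 3) * (chain_var (n + 2) - chain_var (n + 1)) \<ge> real (n + 3) * (10 / 27)"
    by linarith
  hence "real (n + 3) * (10 / 27) \<le> real (n + 3) * (real (n + 2) * (chain_var (n + 2) - chain_var (n + 1)))"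
    by (simp only: mult_ac)
  hence prod: "10 / 27 \<le> real (n + 2) * (chain_var (n + 2) - chain_var (n + 1))"
    by (rule mult_left_le_imp_le) simp
  have div: "c / x \<le> y" if "c \<le> x * y" "x > 0" for c x y :: real
    using that by (simp add: divide_le_eq mult.commute)
  have "10 / 27 / real (n + 2) \<le> chain_var (n + 2) - chain_var (n + 1)"
    by (rule div[OF prod]) simp
  thus ?case by simp
qed

text \<open>Sum the increments, comparing \<open>1 / (n + 1)\<close> with \<open>ln (n + 2) - ln (n + 1)\<close>; for \<open>n \<ge> 4\<close> the starting value
\<open>ln 2\<close> is at most half of \<open>ln n\<close>.\<close>

lemma chain_var_lower_bound:
  assumes "n \<ge> 4"
  shows "chain_var n \<ge> 5 / 27 * ln (real n)"
proof -
  have "chain_var n \<ge> 10 / 27 * (ln (real n + 1) - ln 2)" if "n \<ge> 1" for n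
    using that
  proof (induction n rule: nat_induct_at_least)
    case base
    show ?case by (simp add: chain_var_def chain_mean_def pderiv_pCons)
  next
    case (Suc n)
    have "ln (real n + 2) - ln (real n + 1) = ln (1 + 1 / (real n + 1))"
    proof -
      have "1 + 1 / (real n + 1) = (real n + 2) / (real n + 1)" by (simp add: field_simps)
      thus ?thesis by (simp add: ln_div)
    qed
    also have "\<dots> \<le> 1 / (real n + 1)" by (intro ln_add_one_self_le_self) auto
    finally have "10 / 27 * (ln (real n + 2) - ln (real n + 1)) \<le> 10 / 27 * (1 / (real n + 1))"
      by (intro mult_left_mono) auto
    also have "\<dots> \<le> chain_var (n + 1) - chain_var n"
      using chain_var_increment[of n] Suc.hyps by (simp add: add_ac)
    finally show ?case using Suc.IH by (simp add: add_ac algebra_simps)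
  qed
  from this[of n] assms have 1: "chain_var n \<ge> 10 / 27 * (ln (real n + 1) - ln 2)" by simp
  have "2 * ln 2 = ln (4 :: real)" using ln_realpow[of 2 2] by simp
  also have "\<dots> \<le> ln (real n)" using assms by simp
  finally have "2 * ln 2 \<le> ln (real n)" .
  moreover have "ln (real n) \<le> ln (real n + 1)" using assms by simp
  ultimately show ?thesis using 1 by argo
qed

lemma chain_poly_bernoulli_variance:
  obtains ps where "is_probs ps" "chain_poly n = bernoulli_poly ps" "bvar ps = chain_var n"
proof -
  obtain ps where ps: "is_probs ps" "chain_poly n = bernoulli_poly ps" by (rule chain_poly_bernoulli)
  have "bvar ps = chain_var n"
    by (simp add: chain_var_def chain_mean_def ps bernoulli_poly_pderiv_at_1 bernoulli_poly_pderiv2_at_1)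
  with ps that show ?thesis by blast
qed

section \<open>Removing the first vertex of the chain\<close>

lemma extreme_point_of_convex_hull_finite:
  fixes S :: "'a::euclidean_space set"
  assumes "finite S"
  shows "v extreme_point_of (convex hull S) \<longleftrightarrow> v \<in> S \<and> v \<notin> convex hull (S - {v})"
proof safe
  assume v: "v extreme_point_of (convex hull S)"
  show "v \<in> S" using extreme_point_of_convex_hull[OF v] .
  assume *: "v \<in> convex hull (S - {v})"
  have "convex (convex hull S - {v})" using v by (simp add: extreme_point_of_stillconvex)
  moreover have "S - {v} \<subseteq> convex hull S - {v}" using hull_subset[of S convex] by blast
  ultimately have "convex hull (S - {v}) \<subseteq> convex hull S - {v}" by (rule hull_minimal[rotated])
  thus False using * by blast
next
  assume v: "v \<in> S" "v \<notin> convex hull (S - {v})"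
  thus "v extreme_point_of (convex hull S)"
    using extreme_point_of_convex_hull_insert[of "S - {v}" v] assms by (simp add: insert_absorb)
qed

definition chain_vertices :: "(real \<times> real) set \<Rightarrow> nat" where
  "chain_vertices P = num_vertices (convex hull ({(1, 0), (0, 1)} \<union> P))"

lemma num_vertices_hull_finite:
  assumes "finite S"
  shows "num_vertices (convex hull S) = card {v\<in>S. v \<notin> convex hull (S - {v})}"
  unfolding num_vertices_def extreme_point_of_convex_hull_finite[OF assms]
  by (rule arg_cong[where f = card]) auto

lemma chain_vertices_empty: "chain_vertices {} = 2"
proof -
  have "{v. v extreme_point_of (convex hull {(1, 0), (0, 1)})} = {(1, 0), (0, 1 :: real) :: real \<times> real}"
    by (auto simp: extreme_point_of_convex_hull_2)
  thus ?thesis by (simp add: chain_vertices_def num_vertices_def)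
qed

lemma convex_hull_affine_image:
  fixes f :: "real \<times> real \<Rightarrow> real \<times> real"
  assumes "linear f"
  shows "convex hull ((\<lambda>p. c + f p) ` S) = (\<lambda>p. c + f p) ` (convex hull S)"
proof -
  have *: "(\<lambda>p. c + f p) ` X = (+) c ` (f ` X)" for X by auto
  show ?thesis unfolding * by (simp only: convex_hull_translation convex_hull_linear_image[OF assms])
qed

lemma num_vertices_affine_image:
  fixes f :: "real \<times> real \<Rightarrow> real \<times> real"
  assumes "linear f" "inj f" "finite S"
  shows "num_vertices (convex hull ((\<lambda>p. c + f p) ` S)) = num_vertices (convex hull S)"
proof -
  let ?A = "\<lambda>p. c + f p"
  have inj: "inj ?A" using assms(2) by (auto simp: inj_def)
  have "?A v \<in> convex hull (?A ` S - {?A v}) \<longleftrightarrow> v \<in> convex hull (S - {v})" for v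
  proof -
    have "?A ` S - {?A v} = ?A ` (S - {v})" by (simp add: image_set_diff[OF inj])
    thus ?thesis by (simp only: convex_hull_affine_image[OF assms(1)] inj_image_mem_iff[OF inj])
  qed
  hence "{v \<in> ?A ` S. v \<notin> convex hull (?A ` S - {v})} = ?A ` {v \<in> S. v \<notin> convex hull (S - {v})}"
    by auto
  thus ?thesis using assms(3) inj
    by (simp add: num_vertices_hull_finite card_image inj_on_subset[OF inj])
qed

definition open_triangle :: "(real \<times> real) set" where
  "open_triangle = {(x, y). 0 < x \<and> 0 < y \<and> x + y < 1}"

text \<open>The picture after the affine normalisation that sends \<open>w\<close> to \<open>(1, 0)\<close> and keeps \<open>v\<^sub>2 = (0, 1)\<close>: the old
vertex \<open>v\<^sub>1\<close> becomes \<open>a = (c, 0)\<close> on the \<open>x\<close>-axis beyond \<open>(1, 0)\<close>. Adding \<open>a\<close> creates one new vertex and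
destroys none. Suppose that a point \<open>e\<close> of the old chain is a convex combination of \<open>a\<close> and a point \<open>b\<close>
of the hull of the other old points. The segment from \<open>e\<close> to \<open>a\<close> crosses \<open>[(1, 0), (0, 1)]\<close> in a point \<open>q\<close>,
and \<open>e\<close> lies between \<open>b\<close> and \<open>q\<close>, so \<open>e\<close> was not a vertex before either. For the end points \<open>(1, 0)\<close> and
\<open>(0, 1)\<close>, which lie on this segment, the sign of a coordinate excludes such a combination.\<close>

lemma num_vertices_chain_insert:
  assumes P: "finite P" "P \<subseteq> open_triangle" and c: "c > 1"
  shows "num_vertices (convex hull ({(c, 0), (1, 0), (0, 1)} \<union> P)) = Suc (chain_vertices P)"
proof -
  define S where "S = {(1, 0), (0, 1)} \<union> P"
  define a :: "real \<times> real" where "a = (c, 0)"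
  have fin: "finite S" using P by (simp add: S_def)
  have Ssub: "S \<subseteq> {p. 0 \<le> fst p} \<inter> {p. 0 \<le> snd p} \<inter> {p. fst p + snd p \<le> 1}"
    using P by (auto simp: S_def open_triangle_def)
  have cvx: "convex ({p::real \<times> real. 0 \<le> fst p} \<inter> {p. 0 \<le> snd p} \<inter> {p. fst p + snd p \<le> 1})"
  proof (rule convexI)
    fix p q :: "real \<times> real" and u v :: real
    assume p: "p \<in> {p. 0 \<le> fst p} \<inter> {p. 0 \<le> snd p} \<inter> {p. fst p + snd p \<le> 1}"
      and q: "q \<in> {p. 0 \<le> fst p} \<inter> {p. 0 \<le> snd p} \<inter> {p. fst p + snd p \<le> 1}"
      and uv: "0 \<le> u" "0 \<le> v" "u + v = 1"
    have "u * (fst p + snd p) + v * (fst q + snd q) \<le> u * 1 + v * 1"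
      using p q uv by (intro add_mono mult_left_mono) auto
    thus "u *\<^sub>R p + v *\<^sub>R q \<in> {p. 0 \<le> fst p} \<inter> {p. 0 \<le> snd p} \<inter> {p. fst p + snd p \<le> 1}"
      using p q uv by (auto simp: algebra_simps)
  qed
  have hullS: "convex hull S \<subseteq> {p. 0 \<le> fst p} \<inter> {p. 0 \<le> snd p} \<inter> {p. fst p + snd p \<le> 1}"
    using Ssub cvx by (rule hull_minimal)
  have anS: "a \<notin> convex hull S" using hullS c by (auto simp: a_def)
  have "a \<notin> S" using anS by (metis hull_inc)
  have key: "e \<notin> convex hull (insert a (S - {e}))" if e: "e \<in> S" "e \<notin> convex hull (S - {e})" for e
  proof
    assume *: "e \<in> convex hull (insert a (S - {e}))"
    have "(1, 0) \<in> S - {e} \<or> (0, 1) \<in> S - {e}"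
      by (cases "e = (1, 0)") (auto simp: S_def)
    hence ne: "S - {e} \<noteq> {}" by blast
    from * obtain u v b where uv: "0 \<le> u" "0 \<le> v" "u + v = 1" and b: "b \<in> convex hull (S - {e})"
      and eq: "e = u *\<^sub>R a + v *\<^sub>R b"
      unfolding convex_hull_insert[OF ne] mem_Collect_eq by metis
    have b0: "0 \<le> fst b" "0 \<le> snd b" "fst b + snd b \<le> 1"
      using b hullS hull_mono[of "S - {e}" S convex] by blast+
    have v: "v = 1 - u" using uv by simp
    have "u \<noteq> 0" using e(2) b eq uv by auto
    hence u0: "u > 0" using uv by simp
    have "u \<noteq> 1" using eq uv e(1) \<open>a \<notin> S\<close> by auto
    hence u1: "u < 1" using uv by simp
    have fe: "fst e = u * c + (1 - u) * fst b" and se: "snd e = (1 - u) * snd b"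
      by (simp_all add: eq a_def v)
    consider "e = (1, 0)" | "e = (0, 1)" | "e \<in> P" using e(1) by (auto simp: S_def)
    thus False
    proof cases
      case 1
      have "convex hull (S - {e}) \<subseteq> {p. 0 < snd p}"
      proof (rule hull_minimal)
        show "S - {e} \<subseteq> {p. 0 < snd p}" using P 1 by (auto simp: S_def open_triangle_def)
        show "convex {p::real \<times> real. 0 < snd p}"
          using convex_halfspace_gt[of 0 "(0, 1) :: real \<times> real"] by (simp add: inner_prod_def)
      qed
      hence "snd b > 0" using b by blast
      hence "snd e > 0" using se u1 by simp
      thus False using 1 by simp
    next
      case 2
      have "u * c > 0" using u0 c by simp
      moreover have "(1 - u) * fst b \<ge> 0" using u1 b0 by simp
      ultimately have "fst e > 0" using fe by simp
      thus False using 2 by simp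
    next
      case 3
      hence e1: "fst e + snd e < 1" "0 < fst e" "0 < snd e" using P by (auto simp: open_triangle_def)
      have corners: "(1, 0) \<in> S - {e}" "(0, 1) \<in> S - {e}" using e1 by (auto simp: S_def)
      define g where "g = fst e + snd e"
      \<comment> \<open>The coordinate sum is \<open>g < 1\<close> at \<open>e\<close> and \<open>c > 1\<close> at \<open>a\<close>; it equals 1 at parameter \<open>t\<close>.\<close>
      define t where "t = (1 - g) / (c - g)"
      have g: "g < 1" using e1 by (simp add: g_def)
      have t: "0 < t" "t < 1" using g c by (auto simp: t_def field_simps)
      define q where "q = (1 - t) *\<^sub>R e + t *\<^sub>R a"
      have "fst q + snd q = (1 - t) * g + t * c" by (simp add: q_def g_def a_def algebra_simps)
      also have "\<dots> = g + t * (c - g)" by (simp add: algebra_simps)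
      also have "\<dots> = 1" using g c by (simp add: t_def)
      finally have q1: "fst q + snd q = 1" .
      have q0: "0 \<le> fst q" "0 \<le> snd q" using e1 t c by (auto simp: q_def a_def)
      have "q = fst q *\<^sub>R (1, 0) + snd q *\<^sub>R (0, 1)" by (simp add: prod_eq_iff)
      also have "\<dots> \<in> convex hull (S - {e})"
        by (intro convexD[OF convex_convex_hull] hull_inc corners q0 q1)
      finally have q: "q \<in> convex hull (S - {e})" .
      \<comment> \<open>Eliminate \<open>a\<close> from \<open>e = u a + (1 - u) b\<close> and \<open>q = (1 - t) e + t a\<close>.\<close>
      define s where "s = u / (u + t * (1 - u))"
      have den: "u + t * (1 - u) > 0" using u0 u1 t by (intro add_pos_pos) auto
      have s: "0 \<le> s" "s \<le> 1" using u0 u1 t den by (auto simp: s_def field_simps)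
      have s1: "1 - s = t * (1 - u) / (u + t * (1 - u))" using den by (simp add: s_def field_simps)
      have "(u + t * (1 - u)) *\<^sub>R e = u *\<^sub>R q + (t * (1 - u)) *\<^sub>R b"
        unfolding q_def by (simp add: prod_eq_iff fe se a_def) (simp add: algebra_simps)
      hence "(1 / (u + t * (1 - u))) *\<^sub>R ((u + t * (1 - u)) *\<^sub>R e) =
             (1 / (u + t * (1 - u))) *\<^sub>R (u *\<^sub>R q + (t * (1 - u)) *\<^sub>R b)" by simp
      hence "e = s *\<^sub>R q + (1 - s) *\<^sub>R b"
        using den unfolding s1 unfolding s_def by (simp add: scaleR_add_right)
      also have "\<dots> \<in> convex hull (S - {e})"
        by (intro convexD[OF convex_convex_hull] q b) (use s in auto)
      finally show False using e(2) by contradiction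
    qed
  qed
  have "num_vertices (convex hull (insert a S)) =
     card {v\<in>insert a S. v \<notin> convex hull (insert a S - {v})}"
    using fin by (intro num_vertices_hull_finite) auto
  also have "{v\<in>insert a S. v \<notin> convex hull (insert a S - {v})} =
     insert a {v\<in>S. v \<notin> convex hull (S - {v})}"
  proof (intro set_eqI iffI)
    fix v assume v: "v \<in> {v\<in>insert a S. v \<notin> convex hull (insert a S - {v})}"
    show "v \<in> insert a {v\<in>S. v \<notin> convex hull (S - {v})}"
    proof (cases "v = a")
      case False
      have "convex hull (S - {v}) \<subseteq> convex hull (insert a S - {v})" by (intro hull_mono) auto
      thus ?thesis using v False by auto
    qed auto
  next
    fix v assume v: "v \<in> insert a {v\<in>S. v \<notin> convex hull (S - {v})}"
    show "v \<in> {v\<in>insert a S. v \<notin> convex hull (insert a S - {v})}"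
    proof (cases "v = a")
      case True
      thus ?thesis using anS \<open>a \<notin> S\<close> by auto
    next
      case False
      hence "insert a S - {v} = insert a (S - {v})" by auto
      thus ?thesis using v key[of v] False by auto
    qed
  qed
  also have "card \<dots> = Suc (num_vertices (convex hull S))"
    using fin \<open>a \<notin> S\<close> by (subst num_vertices_hull_finite) auto
  also have "insert a S = {(c, 0), (1, 0), (0, 1)} \<union> P" by (auto simp: S_def a_def)
  finally show ?thesis by (simp add: chain_vertices_def S_def)
qed

text \<open>The points \<open>R\<close> lie in the triangle spanned by \<open>(c, 0)\<close>, \<open>(1, 0)\<close>, \<open>(0, 1)\<close> and do not change the hull.\<close>

lemma chain_vertices_step:
  assumes "finite P" "P \<subseteq> open_triangle" "c > 1" 
    and "\<And>x y. (x, y) \<in> R \<Longrightarrow> 0 \<le> y \<and> x + y \<ge> 1 \<and> x + c * y \<le> c"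
  shows "num_vertices (convex hull ({(c, 0), (1, 0), (0, 1)} \<union> P \<union> R)) = Suc (chain_vertices P)"
proof -
  let ?S = "{(c, 0), (1, 0), (0, 1)} \<union> P"
  have "R \<subseteq> convex hull ?S"
  proof
    fix p assume p: "p \<in> R"
    obtain x y where xy: "p = (x, y)" by (cases p)
    have *: "0 \<le> y" "x + y \<ge> 1" "x + c * y \<le> c" using assms(4) p xy by auto
    define \<alpha> where "\<alpha> = (x + y - 1) / (c - 1)"
    have "p = \<alpha> *\<^sub>R (c, 0) + (1 - y - \<alpha>) *\<^sub>R (1, 0) + y *\<^sub>R (0, 1)"
    proof -
      have "\<alpha> * (c - 1) = x + y - 1" using assms(3) by (simp add: \<alpha>_def)
      thus ?thesis by (simp add: xy algebra_simps)
    qed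
    moreover have "0 \<le> \<alpha>" "0 \<le> 1 - y - \<alpha>"
      using assms(3) * by (auto simp: \<alpha>_def field_simps)
    ultimately have "p \<in> convex hull {(c, 0), (1, 0), (0, 1)}"
      using *(1) unfolding convex_hull_3 by (intro CollectI exI[of _ \<alpha>] exI[of _ "1 - y - \<alpha>"] exI[of _ y]) auto
    thus "p \<in> convex hull ?S" using hull_mono[of "{(c, 0), (1, 0), (0, 1)}" ?S convex] by auto
  qed
  hence "convex hull (?S \<union> R) = convex hull ?S"
    by (intro antisym hull_minimal hull_mono) (auto intro: hull_inc)
  thus ?thesis using num_vertices_chain_insert[OF assms(1-3)] by simp
qed

section \<open>Measurability of the number of vertices\<close>

text \<open>Separation from a finite set is an open condition on the direction, so directions from a countable
dense set suffice; this expresses being a vertex by countably many measurable conditions.\<close>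

lemma not_in_convex_hull_iff_separated:
  fixes D :: "'a::euclidean_space set"
  assumes D: "\<And>U. open U \<Longrightarrow> U \<noteq> {} \<Longrightarrow> \<exists>d\<in>D. d \<in> U" and S: "finite S"
  shows "v \<notin> convex hull S \<longleftrightarrow> (\<exists>d\<in>D. \<forall>s\<in>S. inner d s < inner d v)"
proof
  assume v: "v \<notin> convex hull S"
  have "closed (convex hull S)" using S by (simp add: finite_imp_compact_convex_hull compact_imp_closed)
  from separating_hyperplane_closed_point[OF convex_convex_hull this v]
  obtain a b where ab: "inner a v < b" "\<forall>x\<in>convex hull S. inner a x > b" by blast
  have "open (\<Inter>s\<in>S. {d. inner d s < inner d v})" (is "open ?U")
    using S by (intro open_INT) (auto intro!: open_Collect_less continuous_intros)
  moreover have "?U \<noteq> {}"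
  proof -
    have "inner (- a) s < inner (- a) v" if "s \<in> S" for s
      using ab(1) bspec[OF ab(2) hull_inc[OF that]] by simp
    hence "- a \<in> ?U" by blast
    thus ?thesis by (metis empty_iff)
  qed
  ultimately obtain d where "d \<in> D" "d \<in> ?U" by (metis D)
  thus "\<exists>d\<in>D. \<forall>s\<in>S. inner d s < inner d v" by (intro bexI[of _ d]) auto
next
  assume "\<exists>d\<in>D. \<forall>s\<in>S. inner d s < inner d v"
  then obtain d where d: "\<forall>s\<in>S. inner d s < inner d v" by blast
  have "convex hull S \<subseteq> {x. inner d x < inner d v}"
    by (rule hull_minimal) (use d in \<open>auto simp: convex_halfspace_lt\<close>)
  thus "v \<notin> convex hull S" by auto
qed

lemma measurable_num_vertices:
  fixes Y :: "nat \<Rightarrow> 'a \<Rightarrow> real \<times> real"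
  assumes I: "finite I" and Y[measurable]: "\<And>i. i \<in> I \<Longrightarrow> Y i \<in> borel_measurable M"
  shows "(\<lambda>x. num_vertices (convex hull ((\<lambda>i. Y i x) ` I))) \<in> measurable M (count_space UNIV)"
proof -
  obtain D :: "(real \<times> real) set" where D: "countable D" "\<And>U. open U \<Longrightarrow> U \<noteq> {} \<Longrightarrow> \<exists>d\<in>D. d \<in> U"
    using countable_dense_exists by metis
  have [measurable]: "Measurable.pred M (\<lambda>x. Y i x \<noteq> Y j x)" if "i \<in> I" "j \<in> I" for i j
    using that by measurable
  \<comment> \<open>Coinciding points must be counted once: only the smallest index of each vertex is marked.\<close>
  define vert where "vert i x \<longleftrightarrow> (\<exists>d\<in>D. \<forall>j\<in>I. Y j x \<noteq> Y i x \<longrightarrow> inner d (Y j x) < inner d (Y i x)) \<and>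
     (\<forall>j\<in>{j\<in>I. j < i}. Y j x \<noteq> Y i x)" for i x
  have "num_vertices (convex hull ((\<lambda>i. Y i x) ` I)) = (\<Sum>i\<in>I. if vert i x then 1 else 0)" for x
  proof -
    let ?S = "(\<lambda>i. Y i x) ` I"
    have crit: "Y i x \<notin> convex hull (?S - {Y i x}) \<longleftrightarrow>
       (\<exists>d\<in>D. \<forall>j\<in>I. Y j x \<noteq> Y i x \<longrightarrow> inner d (Y j x) < inner d (Y i x))" if "i \<in> I" for i
      using I by (subst not_in_convex_hull_iff_separated[OF D(2)]) auto
    have "inj_on (\<lambda>i. Y i x) {i\<in>I. vert i x}"
    proof (rule inj_onI)
      fix i j assume "i \<in> {i\<in>I. vert i x}" "j \<in> {i\<in>I. vert i x}" "Y i x = Y j x"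
      thus "i = j" unfolding vert_def by (cases i j rule: linorder_cases) auto
    qed
    hence "card ((\<lambda>i. Y i x) ` {i\<in>I. vert i x}) = card {i\<in>I. vert i x}" by (rule card_image)
    also have "(\<lambda>i. Y i x) ` {i\<in>I. vert i x} = {v\<in>?S. v \<notin> convex hull (?S - {v})}"
    proof (intro equalityI subsetI)
      fix v assume "v \<in> (\<lambda>i. Y i x) ` {i\<in>I. vert i x}"
      thus "v \<in> {v\<in>?S. v \<notin> convex hull (?S - {v})}" using crit by (auto simp: vert_def)
    next
      fix v assume v: "v \<in> {v\<in>?S. v \<notin> convex hull (?S - {v})}"
      define i where "i = (LEAST i. i \<in> I \<and> Y i x = v)"
      have i: "i \<in> I \<and> Y i x = v" unfolding i_def by (rule LeastI_ex) (use v in auto)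
      have "\<not> (j \<in> I \<and> Y j x = v)" if "j < i" for j
        using not_less_Least that unfolding i_def by blast
      hence "vert i x" using v i crit[of i] by (auto simp: vert_def)
      thus "v \<in> (\<lambda>i. Y i x) ` {i\<in>I. vert i x}" using i by auto
    qed
    finally show ?thesis using I by (simp add: num_vertices_hull_finite flip: sum.inter_filter)
  qed
  moreover have [measurable]: "Measurable.pred M (vert i)" if "i \<in> I" for i
    unfolding vert_def using I D(1) that by measurable
  ultimately show ?thesis using I by simp
qed

lemma measurable_chain_vertices:
  fixes Y :: "nat \<Rightarrow> 'a \<Rightarrow> real \<times> real"
  assumes I: "finite I" and Y: "\<And>i. i \<in> I \<Longrightarrow> Y i \<in> borel_measurable M"
  shows "(\<lambda>x. chain_vertices ((\<lambda>i. Y i x) ` I)) \<in> measurable M (count_space UNIV)"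
proof -
  \<comment> \<open>The two fixed points become members of the family, at the indices 0 and 1.\<close>
  define Y' where "Y' i x = (if i = 0 then (1, 0) else if i = 1 then (0, 1) else Y (i - 2) x)" for i :: nat and x
  define I' where "I' = {0, 1} \<union> (\<lambda>i. i + 2) ` I"
  have "(\<lambda>i. Y' i x) ` I' = {(1, 0), (0, 1)} \<union> (\<lambda>i. Y i x) ` I" for x
  proof -
    have "(\<lambda>i. Y' i x) ` ((\<lambda>i. i + 2) ` I) = (\<lambda>i. Y i x) ` I"
      unfolding image_image by (rule image_cong) (auto simp: Y'_def)
    thus ?thesis unfolding I'_def image_Un by (auto simp: Y'_def)
  qed
  moreover have "(\<lambda>x. num_vertices (convex hull ((\<lambda>i. Y' i x) ` I'))) \<in> measurable M (count_space UNIV)"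
    by (intro measurable_num_vertices) (use I Y in \<open>auto simp: I'_def Y'_def[abs_def]\<close>)
  ultimately show ?thesis by (simp add: chain_vertices_def)
qed

section \<open>The uniform distribution on the triangle\<close>

lemma open_triangle_borel [measurable]: "open_triangle \<in> sets borel"
proof -
  have "open_triangle = {p. 0 < fst p \<and> 0 < snd p \<and> fst p + snd p < 1}"
    by (auto simp: open_triangle_def)
  also have "\<dots> \<in> sets borel"
    by (intro borel_open open_Collect_conj open_Collect_less continuous_intros)
  finally show ?thesis .
qed

lemma std_triangle_eq: "std_triangle = {p. 0 \<le> fst p \<and> 0 \<le> snd p \<and> fst p + snd p \<le> 1}"
proof -
  have "std_triangle = {p. \<exists>u v. 0 \<le> u \<and> 0 \<le> v \<and> u + v \<le> 1 \<and> p = (u, v)}"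
    unfolding std_triangle_def convex_hull_3_alt by auto
  thus ?thesis by auto
qed

definition tri :: "(real \<times> real) measure" where
  "tri = density lborel (\<lambda>p. 2 * indicator open_triangle p)"

lemma sets_tri [measurable_cong, simp]: "sets tri = sets borel" by (simp add: tri_def)
lemma space_tri [simp]: "space tri = UNIV" by (simp add: tri_def)

lemma nn_integral_lborel2:
  fixes f :: "real \<times> real \<Rightarrow> ennreal"
  assumes [measurable]: "f \<in> borel_measurable borel"
  shows "(\<integral>\<^sup>+p. f p \<partial>lborel) = (\<integral>\<^sup>+x. \<integral>\<^sup>+y. f (x, y) \<partial>lborel \<partial>lborel)"
proof -
  have "f \<in> borel_measurable (lborel \<Otimes>\<^sub>M lborel)" by (subst lborel_prod) simp
  from lborel.nn_integral_fst[OF this] show ?thesis by (simp add: lborel_prod)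
qed

lemma nn_integral_tri:
  assumes [measurable]: "f \<in> borel_measurable borel"
  shows "(\<integral>\<^sup>+p. f p \<partial>tri) = (\<integral>\<^sup>+p. 2 * indicator open_triangle p * f p \<partial>lborel)"
  unfolding tri_def by (subst nn_integral_density) auto

text \<open>Polar coordinates around \<open>v\<^sub>1\<close>: a point is \<open>(1 - r, r t)\<close>, where \<open>t\<close> is the height at which the line from
\<open>v\<^sub>1\<close> through the point meets the \<open>y\<close>-axis. Under the uniform distribution \<open>t\<close> is uniform and \<open>r\<close> has
density \<open>2 r\<close>, independently.\<close>

lemma nn_integral_tri_polar:
  assumes [measurable]: "f \<in> borel_measurable borel"
  shows "(\<integral>\<^sup>+p. f p \<partial>tri) =
    (\<integral>\<^sup>+r. \<integral>\<^sup>+t. indicator {0<..<1} r * indicator {0<..<1} t * ennreal (2 * r) * f (1 - r, r * t) \<partial>lborel \<partial>lborel)"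
proof -
  let ?g = "\<lambda>p. 2 * indicator open_triangle p * f p"
  have "(\<integral>\<^sup>+p. f p \<partial>tri) = (\<integral>\<^sup>+x. \<integral>\<^sup>+y. ?g (x, y) \<partial>lborel \<partial>lborel)"
    by (simp add: nn_integral_tri nn_integral_lborel2)
  also have "\<dots> = ennreal \<bar>-1\<bar> * (\<integral>\<^sup>+r. \<integral>\<^sup>+y. ?g (1 + (-1) * r, y) \<partial>lborel \<partial>lborel)"
    by (rule nn_integral_real_affine) auto
  also have "\<dots> = (\<integral>\<^sup>+r. \<integral>\<^sup>+y. ?g (1 - r, y) \<partial>lborel \<partial>lborel)" by simp
  also have "\<dots> = (\<integral>\<^sup>+r. \<integral>\<^sup>+t. indicator {0<..<1} r * indicator {0<..<1} t * ennreal (2 * r) * f (1 - r, r * t) \<partial>lborel \<partial>lborel)"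
  proof (rule nn_integral_cong)
    fix r :: real
    show "(\<integral>\<^sup>+y. ?g (1 - r, y) \<partial>lborel) =
       (\<integral>\<^sup>+t. indicator {0<..<1} r * indicator {0<..<1} t * ennreal (2 * r) * f (1 - r, r * t) \<partial>lborel)"
    proof (cases "0 < r \<and> r < 1")
      case True
      have "(\<integral>\<^sup>+y. ?g (1 - r, y) \<partial>lborel) = ennreal \<bar>r\<bar> * (\<integral>\<^sup>+t. ?g (1 - r, 0 + r * t) \<partial>lborel)"
        using True by (intro nn_integral_real_affine) auto
      also have "\<dots> = (\<integral>\<^sup>+t. ennreal r * ?g (1 - r, r * t) \<partial>lborel)"
        using True by (subst nn_integral_cmult[symmetric]) auto
      also have "\<dots> = (\<integral>\<^sup>+t. indicator {0<..<1} r * indicator {0<..<1} t * ennreal (2 * r) * f (1 - r, r * t) \<partial>lborel)"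
        using True
        by (intro nn_integral_cong)
           (auto simp: indicator_def open_triangle_def ennreal_mult zero_less_mult_iff mult_ac)
      finally show ?thesis .
    next
      case False
      have "(\<integral>\<^sup>+y. ?g (1 - r, y) \<partial>lborel) = (\<integral>\<^sup>+(y::real). 0 \<partial>lborel)"
        using False by (intro nn_integral_cong) (auto simp: open_triangle_def indicator_def)
      moreover have "indicator {0<..<1} r = (0 :: ennreal)" using False by auto
      ultimately show ?thesis by simp
    qed
  qed
  finally show ?thesis .
qed

lemma nn_integral_beta:
  "(\<integral>\<^sup>+t. indicator {0<..<1} t * ennreal (t ^ a * (1 - t) ^ b) \<partial>lborel) =
     ennreal (fact a * fact b / fact (a + b + 1))"
proof -
  have "((\<lambda>t. t powr real a * (1 - t) powr real b) has_integral
      Beta (real a + 1) (real b + 1)) {0..1::real}"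
    using has_integral_Beta_real[of "real a + 1" "real b + 1"] by simp
  from nn_integral_has_integral_lebesgue[OF _ this]
  have "(\<integral>\<^sup>+t. ennreal (indicator {0..1} t * (t powr real a * (1 - t) powr real b)) \<partial>lborel) =
     ennreal (Beta (real a + 1) (real b + 1))" by simp
  also have "Beta (real a + 1) (real b + 1) = fact a * fact b / fact (a + b + 1)"
  proof -
    have "Gamma (1 + real (a + b + 1)) = fact (a + b + 1)" by (rule Gamma_fact)
    moreover have "real a + 1 + (real b + 1) = 1 + real (a + b + 1)" by simp
    ultimately have "Gamma (real a + 1 + (real b + 1)) = fact (a + b + 1)" by metis
    thus ?thesis using Gamma_fact[of a, where ?'a = real] Gamma_fact[of b, where ?'a = real]
      by (simp add: Beta_def add.commute)
  qed
  also have "(\<integral>\<^sup>+t. ennreal (indicator {0..1} t * (t powr real a * (1 - t) powr real b)) \<partial>lborel) =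
    (\<integral>\<^sup>+t. indicator {0<..<1} t * ennreal (t ^ a * (1 - t) ^ b) \<partial>lborel)"
    using AE_lborel_singleton[of "0::real"] AE_lborel_singleton[of "1::real"]
    by (intro nn_integral_cong_AE, eventually_elim) (auto simp: indicator_def powr_realpow)
  finally show ?thesis .
qed

lemma emeasure_tri_UNIV: "emeasure tri UNIV = 1"
proof -
  have one: "(\<integral>\<^sup>+t. indicator {0<..<1::real} t \<partial>lborel) = 1" by simp
  have "emeasure tri UNIV = (\<integral>\<^sup>+p. 1 \<partial>tri)" by simp
  also have "\<dots> = (\<integral>\<^sup>+r. \<integral>\<^sup>+t. indicator {0<..<1} r * ennreal (2 * r) * indicator {0<..<1::real} t \<partial>lborel \<partial>lborel)"
    by (subst nn_integral_tri_polar) (simp_all add: mult_ac)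
  also have "\<dots> = (\<integral>\<^sup>+r. ennreal 2 * (indicator {0<..<1} r * ennreal (r ^ 1 * (1 - r) ^ 0)) \<partial>lborel)"
    by (subst nn_integral_cmult) (auto simp: one indicator_def ennreal_mult intro!: nn_integral_cong)
  also have "\<dots> = ennreal 2 * ennreal (1 / 2)"
    by (subst nn_integral_cmult, simp, subst nn_integral_beta) (simp add: numeral_2_eq_2)
  also have "\<dots> = 1" by (subst ennreal_mult[symmetric]) auto
  finally show ?thesis .
qed

lemma prob_space_tri: "prob_space tri"
  by (rule prob_spaceI) (simp add: emeasure_tri_UNIV)

lemma AE_tri: "AE p in tri. p \<in> open_triangle"
  unfolding tri_def by (subst AE_density) (auto simp: indicator_def)

lemma std_triangle_borel [measurable]: "std_triangle \<in> sets borel"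
  unfolding std_triangle_eq
  by (intro borel_closed closed_Collect_conj closed_Collect_le continuous_intros)

lemma AE_triangles: "AE p in lborel. p \<in> std_triangle \<longleftrightarrow> p \<in> open_triangle"
proof -
  have "AE p in lborel \<Otimes>\<^sub>M lborel. p \<in> std_triangle \<longleftrightarrow> p \<in> open_triangle"
  proof (rule lborel_pair.AE_pair_measure)
    have "{p. p \<in> std_triangle \<longleftrightarrow> p \<in> open_triangle} =
       (std_triangle \<inter> open_triangle) \<union> ((- std_triangle) \<inter> (- open_triangle))" by auto
    also have "\<dots> \<in> sets borel" by measurable
    finally show "{p \<in> space (lborel \<Otimes>\<^sub>M lborel). (p \<in> std_triangle) = (p \<in> open_triangle)} \<in> sets (lborel \<Otimes>\<^sub>M lborel)"
      unfolding lborel_prod by simp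
    show "AE x in lborel. AE y in lborel. ((x, y) \<in> std_triangle) = ((x, y) \<in> open_triangle)"
      using AE_lborel_singleton[of "0::real"]
    proof eventually_elim
      case (elim x)
      show ?case using AE_lborel_singleton[of "0::real"] AE_lborel_singleton[of "1 - x"]
        by eventually_elim (use elim in \<open>auto simp: std_triangle_eq open_triangle_def\<close>)
    qed
  qed
  thus ?thesis by (simp only: lborel_prod)
qed

lemma emeasure_std_triangle: "emeasure lborel std_triangle = ennreal (1 / 2)"
proof -
  have "emeasure lborel std_triangle = emeasure lborel open_triangle"
    by (intro emeasure_eq_AE AE_triangles) auto
  moreover have *: "1 = 2 * emeasure lborel open_triangle"
    using emeasure_tri_UNIV unfolding tri_def
    by (subst (asm) emeasure_density) (auto simp: nn_integral_cmult)
  have "emeasure lborel open_triangle = ennreal (1/2)"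
  proof (cases "emeasure lborel open_triangle" rule: ennreal_cases)
    case (real a)
    hence "ennreal 1 = ennreal (2 * a)" using * by (simp add: ennreal_mult)
    hence "2 * a = 1" using real(1) by (subst (asm) ennreal_inj) auto
    hence "a = 1 / 2" by simp
    thus ?thesis by (simp only: real)
  next
    case top
    have "2 * top = (top :: ennreal)" by (simp add: ennreal_mult_eq_top_iff)
    thus ?thesis using * unfolding top by simp
  qed
  ultimately show ?thesis by simp
qed

lemma uniform_measure_std_triangle: "uniform_measure lborel std_triangle = tri"
proof -
  have "indicator std_triangle x / emeasure lborel std_triangle = 2 * indicator std_triangle x" for x
  proof -
    have "1 / ennreal (1 / 2) = 2"
      by (subst ennreal_1[symmetric], subst divide_ennreal) auto
    thus ?thesis unfolding emeasure_std_triangle by (auto simp: indicator_def)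
  qed
  hence "uniform_measure lborel std_triangle = density lborel (\<lambda>x. 2 * indicator std_triangle x)"
    by (simp add: uniform_measure_def)
  also have "\<dots> = tri" unfolding tri_def
    using AE_triangles by (intro density_cong) (auto simp: indicator_def)
  finally show ?thesis .
qed

section \<open>The self-similarity of the triangle\<close>

text \<open>For \<open>w = (u, t (1 - u))\<close>, the point on the line from \<open>v\<^sub>1\<close> to \<open>(0, t)\<close> with first coordinate \<open>u\<close>, this is the
affine map with \<open>(1, 0) \<mapsto> w\<close>, \<open>(0, 1) \<mapsto> v\<^sub>2\<close> and \<open>(0, 0) \<mapsto> (0, t)\<close>. The preimage of \<open>v\<^sub>1\<close> is \<open>(1 / u, 0)\<close>.\<close>

definition aff :: "real \<Rightarrow> real \<Rightarrow> real \<times> real \<Rightarrow> real \<times> real" where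
  "aff t u p = (u * fst p, t - u * t * fst p + (1 - t) * snd p)"

text \<open>The image of the open triangle under \<open>aff t u\<close>, in coordinates. For \<open>u = 1\<close> it is the part of the open
triangle above the line from \<open>v\<^sub>1\<close> to \<open>(0, t)\<close>.\<close>

definition corner :: "real \<Rightarrow> real \<Rightarrow> (real \<times> real) set" where
  "corner t u = {p. 0 < fst p \<and> t - t * fst p < snd p \<and> fst p / u + (snd p - t + t * fst p) / (1 - t) < 1}"

lemma corner_borel [measurable]: "corner t u \<in> sets borel"
proof -
  have "open (corner t u)" unfolding corner_def divide_inverse
    by (intro open_Collect_conj open_Collect_less continuous_intros)
  thus ?thesis by simp
qed

lemma aff_borel [measurable]: "aff t u \<in> borel_measurable borel"
  unfolding aff_def[abs_def]
  by (intro borel_measurable_continuous_onI continuous_intros)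

lemma aff_in_corner:
  assumes "0 < u" "t < 1"
  shows "aff t u p \<in> corner t u \<longleftrightarrow> p \<in> open_triangle"
proof -
  have "fst (aff t u p) / u = fst p" using assms by (simp add: aff_def)
  moreover have "(snd (aff t u p) - t + t * fst (aff t u p)) / (1 - t) = snd p"
    using assms by (simp add: aff_def)
  moreover have "0 < fst (aff t u p) \<longleftrightarrow> 0 < fst p" using assms by (simp add: aff_def zero_less_mult_iff)
  moreover have "t - t * fst (aff t u p) < snd (aff t u p) \<longleftrightarrow> 0 < snd p"
    using assms by (simp add: aff_def zero_less_mult_iff)
  ultimately show ?thesis unfolding corner_def by (cases p) (simp add: open_triangle_def)
qed

lemma corner_mono:
  assumes "0 < u" "u \<le> 1" "0 < t" "t < 1"
  shows "corner t u \<subseteq> corner t 1" "corner t u \<subseteq> open_triangle"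
proof -
  show *: "corner t u \<subseteq> corner t 1"
  proof
    fix p assume p: "p \<in> corner t u"
    hence "fst p / 1 \<le> fst p / u" using assms by (intro divide_left_mono) (auto simp: corner_def)
    thus "p \<in> corner t 1" using p by (auto simp: corner_def)
  qed
  have "corner t 1 \<subseteq> open_triangle"
  proof
    fix p assume p: "p \<in> corner t 1"
    obtain x y where xy: "p = (x, y)" by (cases p)
    have 1: "0 < x" "t - t * x < y" "x + (y - t + t * x) / (1 - t) < 1" using p by (auto simp: corner_def xy)
    have "(y - t + t * x) / (1 - t) > 0" using 1 assms by (intro divide_pos_pos) auto
    hence "x < 1" using 1 by linarith
    hence "0 < t * (1 - x)" using assms by simp
    hence "0 < y" using 1 by (simp add: algebra_simps)
    moreover have "y - t + t * x < (1 - x) * (1 - t)" 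
    proof -
      have "(y - t + t * x) / (1 - t) < 1 - x" using 1(3) by linarith
      thus ?thesis using assms by (simp only: pos_divide_less_eq[of "1 - t"]) 
    qed
    hence "x + y < 1" by (simp add: algebra_simps)
    ultimately show "p \<in> open_triangle" using 1 by (auto simp: open_triangle_def xy)
  qed
  with * show "corner t u \<subseteq> open_triangle" by blast
qed

lemma corner_1_slope:
  assumes "0 < t" "t < 1" "p \<in> open_triangle"
  shows "p \<in> corner t 1 \<longleftrightarrow> t < snd p / (1 - fst p)"
proof -
  obtain x y where xy: "p = (x, y)" by (cases p)
  have 1: "0 < x" "0 < y" "x + y < 1" using assms by (auto simp: open_triangle_def xy)
  have "y - t + t * x < (1 - x) * (1 - t)" using 1 by (simp add: algebra_simps)
  hence "x + (y - t + t * x) / (1 - t) < 1"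
  proof -
    assume "y - t + t * x < (1 - x) * (1 - t)"
    hence "(y - t + t * x) / (1 - t) < 1 - x" using assms by (simp only: pos_divide_less_eq[of "1 - t"])
    thus ?thesis by linarith
  qed
  thus ?thesis using 1 by (auto simp: corner_def xy pos_less_divide_eq algebra_simps)
qed

text \<open>The map is triangular, so two one-dimensional substitutions give the Jacobian \<open>u (1 - t)\<close>.\<close>

lemma nn_integral_lborel_aff:
  assumes [measurable]: "f \<in> borel_measurable borel" and t: "t < 1" and u: "0 < u"
  shows "(\<integral>\<^sup>+p. f p \<partial>lborel) = ennreal (u * (1 - t)) * (\<integral>\<^sup>+p. f (aff t u p) \<partial>lborel)"
proof -
  have "(\<integral>\<^sup>+p. f p \<partial>lborel) = (\<integral>\<^sup>+x. \<integral>\<^sup>+y. f (x, y) \<partial>lborel \<partial>lborel)"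
    by (rule nn_integral_lborel2) auto
  also have "\<dots> = ennreal \<bar>u\<bar> * (\<integral>\<^sup>+x. \<integral>\<^sup>+y. f (0 + u * x, y) \<partial>lborel \<partial>lborel)"
    by (rule nn_integral_real_affine) (use u in auto)
  also have "\<dots> = ennreal u * (\<integral>\<^sup>+x. ennreal (1 - t) * (\<integral>\<^sup>+y. f (u * x, (t - u * t * x) + (1 - t) * y) \<partial>lborel) \<partial>lborel)"
  proof -
    have "(\<integral>\<^sup>+y. f (0 + u * x, y) \<partial>lborel) = ennreal \<bar>1 - t\<bar> * (\<integral>\<^sup>+y. f (0 + u * x, (t - u * t * x) + (1 - t) * y) \<partial>lborel)" for x
      by (rule nn_integral_real_affine) (use t in auto)
    thus ?thesis using t u by simp
  qed
  also have "\<dots> = ennreal u * (ennreal (1 - t) * (\<integral>\<^sup>+x. \<integral>\<^sup>+y. f (aff t u (x, y)) \<partial>lborel \<partial>lborel))"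
    by (subst nn_integral_cmult[symmetric]) (auto simp: aff_def)
  also have "(\<integral>\<^sup>+x. \<integral>\<^sup>+y. f (aff t u (x, y)) \<partial>lborel \<partial>lborel) = (\<integral>\<^sup>+p. f (aff t u p) \<partial>lborel)"
    by (rule nn_integral_lborel2[symmetric]) measurable
  finally show ?thesis using t u by (simp add: ennreal_mult mult.assoc)
qed

text \<open>A uniform point restricted to the corner is the image of a uniform point, with total mass \<open>u (1 - t)\<close>.\<close>

lemma nn_integral_tri_corner:
  assumes [measurable]: "f \<in> borel_measurable borel" and tu: "0 < t" "t < 1" "0 < u" "u \<le> 1"
  shows "(\<integral>\<^sup>+p. indicator (corner t u) p * f p \<partial>tri) = ennreal (u * (1 - t)) * (\<integral>\<^sup>+p. f (aff t u p) \<partial>tri)"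
proof -
  have "(\<integral>\<^sup>+p. indicator (corner t u) p * f p \<partial>tri) = (\<integral>\<^sup>+p. 2 * indicator open_triangle p * (indicator (corner t u) p * f p) \<partial>lborel)"
    by (rule nn_integral_tri) measurable
  also have "\<dots> = (\<integral>\<^sup>+p. 2 * indicator (corner t u) p * f p \<partial>lborel)"
    using corner_mono(2)[OF tu(3,4,1,2)] by (intro nn_integral_cong) (auto simp: indicator_def)
  also have "\<dots> = ennreal (u * (1 - t)) * (\<integral>\<^sup>+p. 2 * indicator (corner t u) (aff t u p) * f (aff t u p) \<partial>lborel)"
    by (rule nn_integral_lborel_aff) (use tu in measurable)
  also have "(\<integral>\<^sup>+p. 2 * indicator (corner t u) (aff t u p) * f (aff t u p) \<partial>lborel) =
     (\<integral>\<^sup>+p. 2 * indicator open_triangle p * f (aff t u p) \<partial>lborel)"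
    using tu by (intro nn_integral_cong) (auto simp: indicator_def aff_in_corner)
  also have "\<dots> = (\<integral>\<^sup>+p. f (aff t u p) \<partial>tri)"
    by (rule nn_integral_tri[symmetric]) measurable
  finally show ?thesis .
qed

lemma emeasure_tri_corner:
  assumes "0 < t" "t < 1" "0 < u" "u \<le> 1"
  shows "emeasure tri (corner t u) = ennreal (u * (1 - t))"
  using nn_integral_tri_corner[of "\<lambda>_. 1", OF _ assms] emeasure_tri_UNIV by simp

lemma emeasure_tri_corner_diff:
  assumes "0 < t" "t < 1" "0 < u" "u \<le> 1"
  shows "emeasure tri (corner t 1 - corner t u) = ennreal ((1 - u) * (1 - t))"
proof -
  have "emeasure tri (corner t 1 - corner t u) = emeasure tri (corner t 1) - emeasure tri (corner t u)"
    using corner_mono[OF assms(3,4,1,2)] by (intro emeasure_Diff) (auto simp: emeasure_tri_corner assms)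
  also have "\<dots> = ennreal ((1 - u) * (1 - t))"
    using assms by (simp add: emeasure_tri_corner ennreal_minus algebra_simps)
  finally show ?thesis .
qed

section \<open>The remaining points, given the first vertex\<close>

interpretation tri: prob_space tri by (rule prob_space_tri)
interpretation tris: product_prob_space "\<lambda>_::nat. tri" UNIV ..

abbreviation triM :: "nat set \<Rightarrow> (nat \<Rightarrow> real \<times> real) measure" where
  "triM I \<equiv> Pi\<^sub>M I (\<lambda>_. tri)"

text \<open>The generating function of the number of vertices for independent uniform points indexed by \<open>I\<close>. The
recursion removes points, so arbitrary finite index sets are needed.\<close>

definition pgf :: "nat set \<Rightarrow> real \<Rightarrow> ennreal" where
  "pgf I z = (\<integral>\<^sup>+x. ennreal (z ^ chain_vertices (x ` I)) \<partial>triM I)"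

lemma measurable_chain_vertices_PiM:
  fixes Y :: "nat \<Rightarrow> 'a \<Rightarrow> real \<times> real"
  assumes "finite I" "\<And>i. i \<in> I \<Longrightarrow> Y i \<in> measurable M tri"
  shows "(\<lambda>x. chain_vertices ((\<lambda>i. Y i x) ` I)) \<in> measurable M (count_space UNIV)"
  by (intro measurable_chain_vertices) (use assms in \<open>auto simp: measurable_cong_sets[OF refl sets_tri]\<close>)

lemma measurable_chain_vertices_component [measurable]:
  assumes "finite I"
  shows "(\<lambda>x. chain_vertices (x ` I)) \<in> measurable (triM I) (count_space UNIV)"
  by (intro measurable_chain_vertices_PiM assms) auto

lemma borel_measurable_nn_integral_triM:
  assumes "case_prod f \<in> borel_measurable (N \<Otimes>\<^sub>M triM J)"
  shows "(\<lambda>x. \<integral>\<^sup>+y. f x y \<partial>triM J) \<in> borel_measurable N"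
proof -
  interpret J: prob_space "triM J" by (intro prob_space_PiM prob_space_tri)
  show ?thesis by (rule J.borel_measurable_nn_integral[OF assms])
qed

text \<open>The product version of the change of variables, by induction on the index set.\<close>

lemma nn_integral_prod_corner:
  assumes tu: "0 < t" "t < 1" "0 < u" "u \<le> 1" and J: "finite J" and h: "h \<in> borel_measurable (triM J)"
  shows "(\<integral>\<^sup>+x. (\<Prod>j\<in>J. indicator (corner t u) (x j)) * h x \<partial>triM J) =
     ennreal (u * (1 - t)) ^ card J * (\<integral>\<^sup>+x. h (\<lambda>j\<in>J. aff t u (x j)) \<partial>triM J)"
  using J h
proof (induction J arbitrary: h rule: finite_induct)
  case empty
  have "integral\<^sup>N (triM {}) h = h (\<lambda>_. undefined)"
    by (simp add: PiM_empty nn_integral_count_space_finite)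
  thus ?case by (simp add: restrict_def PiM_empty nn_integral_count_space_finite)
next
  case (insert i J)
  note [measurable] = insert.prems
  let ?c = "ennreal (u * (1 - t))"
  let ?A = "\<lambda>x. \<lambda>j\<in>J. aff t u (x j)"
  have [measurable]: "(\<lambda>x. (snd x)(i := fst x)) \<in> measurable (tri \<Otimes>\<^sub>M triM J) (triM (insert i J))"
    by (rule measurable_fun_upd[where J = J]) auto
  have A: "?A \<in> measurable (triM J) (triM J)" by measurable
  have A2: "(\<lambda>x. (?A (snd x))(i := fst x)) \<in> measurable (tri \<Otimes>\<^sub>M triM J) (triM (insert i J))"
    by (rule measurable_fun_upd[where J = J]) (auto intro!: measurable_restrict)
  have A3: "(\<lambda>x. \<lambda>j\<in>insert i J. aff t u (x j)) \<in> measurable (triM (insert i J)) (triM (insert i J))" by measurable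
  have mA: "(\<lambda>y. \<integral>\<^sup>+x. h ((?A x)(i := y)) \<partial>triM J) \<in> borel_measurable borel"
  proof -
    have "(\<lambda>x. h ((?A (snd x))(i := fst x))) \<in> borel_measurable (tri \<Otimes>\<^sub>M triM J)"
      using A2 insert.prems by (rule measurable_compose)
    hence "(\<lambda>y. \<integral>\<^sup>+x. h ((?A x)(i := y)) \<partial>triM J) \<in> borel_measurable tri"
      by (intro borel_measurable_nn_integral_triM) (auto simp: split_beta)
    thus ?thesis by (simp add: measurable_cong_sets[OF sets_tri refl])
  qed
  have "(\<integral>\<^sup>+x. (\<Prod>j\<in>insert i J. indicator (corner t u) (x j)) * h x \<partial>triM (insert i J)) =
    (\<integral>\<^sup>+y. \<integral>\<^sup>+x. (\<Prod>j\<in>insert i J. indicator (corner t u) ((x(i := y)) j)) * h (x(i := y)) \<partial>triM J \<partial>tri)"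
    using insert.hyps by (intro tris.product_nn_integral_insert_rev) measurable
  also have "\<dots> = (\<integral>\<^sup>+y. indicator (corner t u) y * (\<integral>\<^sup>+x. (\<Prod>j\<in>J. indicator (corner t u) (x j)) * h (x(i := y)) \<partial>triM J) \<partial>tri)"
  proof (rule nn_integral_cong)
    fix y
    have eq: "(\<Prod>j\<in>insert i J. indicator (corner t u) ((x(i := y)) j)) =
      indicator (corner t u) y * (\<Prod>j\<in>J. indicator (corner t u) (x j) :: ennreal)" for x
    proof -
      have "(\<Prod>j\<in>J. indicator (corner t u) ((x(i := y)) j)) = (\<Prod>j\<in>J. indicator (corner t u) (x j) :: ennreal)"
        using insert.hyps by (intro prod.cong) auto
      thus ?thesis using insert.hyps by simp
    qed
    have "(\<lambda>x. h (x(i := y))) \<in> borel_measurable (triM J)"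
      by (rule measurable_compose[OF _ insert.prems], rule measurable_fun_upd[where J = J]) auto
    thus "(\<integral>\<^sup>+x. (\<Prod>j\<in>insert i J. indicator (corner t u) ((x(i := y)) j)) * h (x(i := y)) \<partial>triM J) =
      indicator (corner t u) y * (\<integral>\<^sup>+x. (\<Prod>j\<in>J. indicator (corner t u) (x j)) * h (x(i := y)) \<partial>triM J)"
      unfolding eq mult.assoc by (intro nn_integral_cmult) measurable
  qed
  also have "\<dots> = (\<integral>\<^sup>+y. indicator (corner t u) y * (?c ^ card J * (\<integral>\<^sup>+x. h ((?A x)(i := y)) \<partial>triM J)) \<partial>tri)"
  proof (rule nn_integral_cong, rule arg_cong[where f = "\<lambda>x. _ * x"])
    fix y
    show "(\<integral>\<^sup>+x. (\<Prod>j\<in>J. indicator (corner t u) (x j)) * h (x(i := y)) \<partial>triM J) =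
      ?c ^ card J * (\<integral>\<^sup>+x. h ((?A x)(i := y)) \<partial>triM J)"
      by (intro insert.IH measurable_compose[OF _ insert.prems] measurable_fun_upd[where J = J]) auto
  qed
  also have "\<dots> = ?c * (\<integral>\<^sup>+y. ?c ^ card J * (\<integral>\<^sup>+x. h ((?A x)(i := aff t u y)) \<partial>triM J) \<partial>tri)"
    using mA by (intro nn_integral_tri_corner[OF _ tu]) simp
  also have "\<dots> = ?c * (?c ^ card J * (\<integral>\<^sup>+y. \<integral>\<^sup>+x. h ((?A x)(i := aff t u y)) \<partial>triM J \<partial>tri))"
    using measurable_compose[OF aff_borel mA]
    by (subst nn_integral_cmult) (simp_all add: measurable_cong_sets[OF sets_tri refl])
  also have "\<dots> = ?c ^ card (insert i J) * (\<integral>\<^sup>+y. \<integral>\<^sup>+x. h ((?A x)(i := aff t u y)) \<partial>triM J \<partial>tri)"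
    using insert.hyps by (simp add: mult.assoc)
  also have "(\<integral>\<^sup>+y. \<integral>\<^sup>+x. h ((?A x)(i := aff t u y)) \<partial>triM J \<partial>tri) =
    (\<integral>\<^sup>+y. \<integral>\<^sup>+x. h (\<lambda>j\<in>insert i J. aff t u ((x(i := y)) j)) \<partial>triM J \<partial>tri)"
    using insert.hyps
    by (intro nn_integral_cong arg_cong[where f = h]) (auto simp: fun_eq_iff restrict_def)
  also have "\<dots> = (\<integral>\<^sup>+x. h (\<lambda>j\<in>insert i J. aff t u (x j)) \<partial>triM (insert i J))"
    using insert.hyps measurable_compose[OF A3 insert.prems] 
    by (intro tris.product_nn_integral_insert_rev[symmetric]) auto
  finally show ?case .
qed

lemma aff_eq_affine: "aff t u p = (0, t) + (u * fst p, (1 - t) * snd p - u * t * fst p)"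
  by (simp add: aff_def)

text \<open>The geometric step in original coordinates: \<open>(u, t (1 - u))\<close> is the lowest point \<open>w\<close>, the points
\<open>aff t u ` P\<close> lie in the corner cut off by \<open>w\<close> and \<open>v\<^sub>2\<close>, and the points \<open>R\<close> lie above the line from \<open>v\<^sub>1\<close> to
\<open>w\<close> but outside that corner.\<close>

lemma chain_vertices_aff:
  assumes tu: "0 < t" "t < 1" "0 < u" "u < 1" and fin: "finite P" "finite R"
    and P: "P \<subseteq> open_triangle" and R: "R \<subseteq> corner t 1 - corner t u"
  shows "chain_vertices (insert (u, t * (1 - u)) (aff t u ` P \<union> R)) = Suc (chain_vertices P)"
proof -
  define f where "f p = (u * fst p, (1 - t) * snd p - u * t * fst p)" for p :: "real \<times> real"
  have lin: "linear f" by (rule linearI) (auto simp: f_def algebra_simps)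
  have inj: "inj f" using tu by (auto simp: inj_def f_def)
  have aff: "aff t u = (\<lambda>p. (0, t) + f p)" by (simp add: fun_eq_iff aff_eq_affine f_def)
  define g where "g p = (fst p / u, (snd p - t + t * fst p) / (1 - t))" for p :: "real \<times> real"
  have ag: "aff t u (g p) = p" for p using tu by (cases p) (simp add: aff_def g_def)
  define R' where "R' = g ` R"
  have R': "aff t u ` R' = R" by (simp add: R'_def image_image ag)
  have "{(1, 0), (0, 1)} \<union> insert (u, t * (1 - u)) (aff t u ` P \<union> R) =
     aff t u ` ({(1 / u, 0), (1, 0), (0, 1)} \<union> P \<union> R')"
    unfolding image_Un R' using tu by (auto simp: aff_def algebra_simps)
  hence "chain_vertices (insert (u, t * (1 - u)) (aff t u ` P \<union> R)) =
     num_vertices (convex hull (aff t u ` ({(1 / u, 0), (1, 0), (0, 1)} \<union> P \<union> R')))"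
    by (simp only: chain_vertices_def)
  also have "\<dots> = num_vertices (convex hull ({(1 / u, 0), (1, 0), (0, 1)} \<union> P \<union> R'))"
    unfolding aff using fin by (intro num_vertices_affine_image lin inj) (auto simp: R'_def)
  also have "\<dots> = Suc (chain_vertices P)"
  proof (rule chain_vertices_step)
    fix x y assume "(x, y) \<in> R'"
    then obtain p where p: "p \<in> R" "x = fst p / u" "y = (snd p - t + t * fst p) / (1 - t)"
      by (auto simp: R'_def g_def)
    have c: "0 < fst p" "t - t * fst p < snd p" "fst p + y < 1" "\<not> x + y < 1"
      using p R by (auto simp: corner_def)
    have "0 \<le> y" unfolding p using c tu by (intro divide_nonneg_pos) auto
    moreover have "x + 1 / u * y \<le> 1 / u"
      using c(3) tu unfolding p(2) by (simp add: divide_simps)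
    ultimately show "0 \<le> y \<and> 1 \<le> x + y \<and> x + 1 / u * y \<le> 1 / u" using c by auto
  qed (use fin P tu in \<open>auto simp: R'_def\<close>)
  finally show ?thesis .
qed

text \<open>For a fixed lowest point \<open>w = (u, t (1 - u))\<close>, the others are conditioned to lie above the line through
\<open>v\<^sub>1\<close> and \<open>w\<close>. Expand over the set \<open>J\<close> of those that fall into the smaller corner at \<open>w\<close>: they form an affine
copy of the original configuration, each at the price \<open>u (1 - t)\<close>, while each of the others contributes only
its probability \<open>(1 - u) (1 - t)\<close>. The factor \<open>z\<close> counts the vertex \<open>v\<^sub>1\<close>, which \<open>w\<close> replaces in the copy.\<close>

lemma nn_integral_corner_condition:
  assumes tu: "0 < t" "t < 1" "0 < u" "u < 1" and K: "finite K" and z: "z \<ge> 0"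
  shows "(\<integral>\<^sup>+x. ennreal (z ^ chain_vertices (insert (u, t * (1 - u)) (x ` K))) * (\<Prod>j\<in>K. indicator (corner t 1) (x j)) \<partial>triM K) =
    (\<Sum>J\<in>Pow K. ennreal (u * (1 - t)) ^ card J * (ennreal z * pgf J z * ennreal ((1 - u) * (1 - t)) ^ card (K - J)))"
proof -
  let ?w = "(u, t * (1 - u))"
  let ?F = "\<lambda>P. ennreal (z ^ chain_vertices (insert ?w P))"
  let ?D = "corner t 1 - corner t u"
  let ?c = "ennreal (u * (1 - t))" let ?d = "ennreal ((1 - u) * (1 - t))"
  have F: "(\<lambda>x. ?F (x ` K)) \<in> borel_measurable (triM K)"
  proof -
    define Y :: "nat \<Rightarrow> (nat \<Rightarrow> real \<times> real) \<Rightarrow> real \<times> real" where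
      "Y i x = (if i = 0 then ?w else x (i - 1))" for i x
    have "(\<lambda>x. chain_vertices ((\<lambda>i. Y i x) ` insert 0 (Suc ` K))) \<in> measurable (triM K) (count_space UNIV)"
      by (intro measurable_chain_vertices_PiM) (use K in \<open>auto simp: Y_def[abs_def]\<close>)
    moreover have "(\<lambda>i. Y i x) ` insert 0 (Suc ` K) = insert ?w (x ` K)" for x
      unfolding image_insert image_image by (simp add: Y_def)
    ultimately show ?thesis by simp
  qed
  have ind: "(indicator (corner t 1) p :: ennreal) = indicator (corner t u) p + indicator ?D p" for p
    using corner_mono(1)[of u t] tu by (auto simp: indicator_def)
  have "(\<integral>\<^sup>+x. ?F (x ` K) * (\<Prod>j\<in>K. indicator (corner t 1) (x j)) \<partial>triM K) =
     (\<integral>\<^sup>+x. (\<Sum>J\<in>Pow K. ?F (x ` K) * ((\<Prod>j\<in>J. indicator (corner t u) (x j)) * (\<Prod>j\<in>K - J. indicator ?D (x j)))) \<partial>triM K)"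
    using K by (simp add: ind prod_add sum_distrib_left)
  also have "\<dots> = (\<Sum>J\<in>Pow K. \<integral>\<^sup>+x. ?F (x ` K) * ((\<Prod>j\<in>J. indicator (corner t u) (x j)) * (\<Prod>j\<in>K - J. indicator ?D (x j))) \<partial>triM K)"
    using F K by (intro nn_integral_sum borel_measurable_times_ennreal borel_measurable_prod_ennreal) auto
  also have "\<dots> = (\<Sum>J\<in>Pow K. ?c ^ card J * (ennreal z * pgf J z * ?d ^ card (K - J)))"
  proof (rule sum.cong[OF refl])
    fix J assume "J \<in> Pow K"
    hence J: "J \<subseteq> K" "finite J" "finite (K - J)" "J \<union> (K - J) = K" using K finite_subset by auto
    \<comment> \<open>Integrate first over the points outside the corner, then substitute for those inside.\<close>
    define h where "h x = (\<integral>\<^sup>+y. ?F (x ` J \<union> y ` (K - J)) * (\<Prod>j\<in>K - J. indicator ?D (y j)) \<partial>triM (K - J))" for x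
    have im: "merge J (K - J) (x, y) ` K = x ` J \<union> y ` (K - J)" for x y
      using J by (auto simp: merge_def image_iff)
    have [measurable]: "(\<lambda>x. ?F (fst x ` J \<union> snd x ` (K - J))) \<in> borel_measurable (triM J \<Otimes>\<^sub>M triM (K - J))"
    proof -
      have "merge J (K - J) \<in> measurable (triM J \<Otimes>\<^sub>M triM (K - J)) (triM K)"
        using measurable_merge[of J "K - J" "\<lambda>_. tri"] J by simp
      note compose = measurable_compose[OF this F]
      have mg: "fst x ` J \<union> snd x ` (K - J) = merge J (K - J) x ` K" for x
        using im[of "fst x" "snd x"] by simp
      show ?thesis unfolding mg by (rule compose)
    qed
    have [measurable]: "h \<in> borel_measurable (triM J)"
      unfolding h_def by (intro borel_measurable_nn_integral_triM) (simp add: split_beta J)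
    have "(\<integral>\<^sup>+x. ?F (x ` K) * ((\<Prod>j\<in>J. indicator (corner t u) (x j)) * (\<Prod>j\<in>K - J. indicator ?D (x j))) \<partial>triM K) =
      (\<integral>\<^sup>+x. \<integral>\<^sup>+y. ?F (merge J (K - J) (x, y) ` K) * ((\<Prod>j\<in>J. indicator (corner t u) (merge J (K - J) (x, y) j)) *
         (\<Prod>j\<in>K - J. indicator ?D (merge J (K - J) (x, y) j))) \<partial>triM (K - J) \<partial>triM J)"
      (is "integral\<^sup>N _ ?f = _")
    proof -
      have "?f \<in> borel_measurable (triM K)"
        using F K J(1) by (intro borel_measurable_times_ennreal borel_measurable_prod_ennreal) auto
      thus ?thesis using tris.product_nn_integral_fold[of J "K - J" ?f] J by simp
    qed
    also have "\<dots> = (\<integral>\<^sup>+x. \<integral>\<^sup>+y. (\<Prod>j\<in>J. indicator (corner t u) (x j)) * (?F (x ` J \<union> y ` (K - J)) * (\<Prod>j\<in>K - J. indicator ?D (y j))) \<partial>triM (K - J) \<partial>triM J)"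
    proof (intro nn_integral_cong)
      fix x y
      have "(\<Prod>j\<in>J. indicator (corner t u) (merge J (K - J) (x, y) j)) = (\<Prod>j\<in>J. indicator (corner t u) (x j) :: ennreal)"
        by (intro prod.cong) (auto simp: merge_def)
      moreover have "(\<Prod>j\<in>K - J. indicator ?D (merge J (K - J) (x, y) j)) = (\<Prod>j\<in>K - J. indicator ?D (y j) :: ennreal)"
        by (intro prod.cong) (auto simp: merge_def)
      ultimately show "?F (merge J (K - J) (x, y) ` K) * ((\<Prod>j\<in>J. indicator (corner t u) (merge J (K - J) (x, y) j)) *
         (\<Prod>j\<in>K - J. indicator ?D (merge J (K - J) (x, y) j))) =
         (\<Prod>j\<in>J. indicator (corner t u) (x j)) * (?F (x ` J \<union> y ` (K - J)) * (\<Prod>j\<in>K - J. indicator ?D (y j)))"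
        by (simp only: im mult_ac)
    qed
    also have "\<dots> = (\<integral>\<^sup>+x. (\<Prod>j\<in>J. indicator (corner t u) (x j)) * h x \<partial>triM J)"
      unfolding h_def
    proof (rule nn_integral_cong, rule nn_integral_cmult)
      fix x assume "x \<in> space (triM J)"
      thus "(\<lambda>y. ?F (x ` J \<union> y ` (K - J)) * (\<Prod>j\<in>K - J. indicator ?D (y j))) \<in> borel_measurable (triM (K - J))"
        using measurable_Pair2[of "\<lambda>x. ?F (fst x ` J \<union> snd x ` (K - J))" "triM J" "triM (K - J)" borel x]
        by (intro borel_measurable_times_ennreal borel_measurable_prod_ennreal) auto
    qed
    also have "\<dots> = ?c ^ card J * (\<integral>\<^sup>+x. h (\<lambda>j\<in>J. aff t u (x j)) \<partial>triM J)"
      using tu by (intro nn_integral_prod_corner J) auto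
    also have "(\<integral>\<^sup>+x. h (\<lambda>j\<in>J. aff t u (x j)) \<partial>triM J) =
       (\<integral>\<^sup>+x. ennreal z * ennreal (z ^ chain_vertices (x ` J)) * ?d ^ card (K - J) \<partial>triM J)"
    proof (rule nn_integral_cong_AE)
      have "AE x in triM J. \<forall>j\<in>J. x j \<in> open_triangle"
        using J by (intro AE_finite_allI AE_PiM_component prob_space_tri AE_tri) auto
      thus "AE x in triM J. h (\<lambda>j\<in>J. aff t u (x j)) = ennreal z * ennreal (z ^ chain_vertices (x ` J)) * ?d ^ card (K - J)"
      proof eventually_elim
        case (elim x)
        have im': "(\<lambda>j\<in>J. aff t u (x j)) ` J = aff t u ` (x ` J)" by (auto simp: image_image)
        have "h (\<lambda>j\<in>J. aff t u (x j)) = (\<integral>\<^sup>+y. ennreal z * ennreal (z ^ chain_vertices (x ` J)) * (\<Prod>j\<in>K - J. indicator ?D (y j)) \<partial>triM (K - J))"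
          unfolding h_def im'
        proof (rule nn_integral_cong)
          fix y
          show "?F (aff t u ` (x ` J) \<union> y ` (K - J)) * (\<Prod>j\<in>K - J. indicator ?D (y j)) =
            ennreal z * ennreal (z ^ chain_vertices (x ` J)) * (\<Prod>j\<in>K - J. indicator ?D (y j))"
          proof (cases "\<forall>j\<in>K - J. y j \<in> ?D")
            case True
            have "chain_vertices (insert ?w (aff t u ` (x ` J) \<union> y ` (K - J))) = Suc (chain_vertices (x ` J))"
              by (rule chain_vertices_aff) (use tu J elim True in auto)
            thus ?thesis using z by (simp add: ennreal_mult)
          next
            case False
            hence "(\<Prod>j\<in>K - J. indicator ?D (y j) :: ennreal) = 0"
              using J by (intro prod_zero) (auto simp: indicator_def)
            thus ?thesis by (simp only: mult_zero_right)
          qed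
        qed
        also have "\<dots> = ennreal z * ennreal (z ^ chain_vertices (x ` J)) * (\<integral>\<^sup>+y. (\<Prod>j\<in>K - J. indicator ?D (y j)) \<partial>triM (K - J))"
          by (intro nn_integral_cmult borel_measurable_prod_ennreal) auto
        also have "(\<integral>\<^sup>+y. (\<Prod>j\<in>K - J. indicator ?D (y j)) \<partial>triM (K - J)) = (\<Prod>j\<in>K - J. \<integral>\<^sup>+p. indicator ?D p \<partial>tri)"
          using J by (intro tris.product_nn_integral_prod) auto
        also have "\<dots> = ?d ^ card (K - J)"
          using tu by (simp add: emeasure_tri_corner_diff)
        finally show ?case .
      qed
    qed
    also have "\<dots> = ennreal z * pgf J z * ?d ^ card (K - J)"
      unfolding pgf_def using J by (simp add: nn_integral_multc nn_integral_cmult)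
    finally show "(\<integral>\<^sup>+x. ?F (x ` K) * ((\<Prod>j\<in>J. indicator (corner t u) (x j)) * (\<Prod>j\<in>K - J. indicator ?D (x j))) \<partial>triM K) =
       ?c ^ card J * (ennreal z * pgf J z * ?d ^ card (K - J))" .
  qed
  finally show ?thesis .
qed

section \<open>The lowest point and the renewal equation\<close>

text \<open>The height at which the line from \<open>v\<^sub>1\<close> through \<open>p\<close> meets the \<open>y\<close>-axis; it orders the points by the angle
under which they are seen from \<open>v\<^sub>1\<close>.\<close>

definition slope :: "real \<times> real \<Rightarrow> real" where
  "slope p = snd p / (1 - fst p)"

lemma slope_borel [measurable]: "slope \<in> borel_measurable borel"
  unfolding slope_def[abs_def] by (intro borel_measurable_divide borel_measurable_diff borel_measurable_const borel_measurable_continuous_onI continuous_intros)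

lemma slope_polar: "r \<noteq> 0 \<Longrightarrow> slope (1 - r, r * t) = t"
  by (simp add: slope_def)

lemma AE_slope_neq: "AE p in tri. slope p \<noteq> s"
proof -
  have "(\<integral>\<^sup>+p. indicator {p. slope p = s} p \<partial>tri) =
    (\<integral>\<^sup>+r. \<integral>\<^sup>+t. indicator {0<..<1} r * indicator {0<..<1} t * ennreal (2 * r) * indicator {p. slope p = s} (1 - r, r * t) \<partial>lborel \<partial>lborel)"
    by (rule nn_integral_tri_polar) measurable
  also have "\<dots> = (\<integral>\<^sup>+(r::real). 0 \<partial>lborel)"
  proof (rule nn_integral_cong)
    fix r :: real
    have "(\<integral>\<^sup>+t. indicator {0<..<1} r * indicator {0<..<1} t * ennreal (2 * r) * indicator {p. slope p = s} (1 - r, r * t) \<partial>lborel)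
        = (\<integral>\<^sup>+(t::real). 0 \<partial>lborel)"
      using AE_lborel_singleton[of s]
      by (intro nn_integral_cong_AE, eventually_elim) (auto simp: indicator_def slope_polar)
    thus "(\<integral>\<^sup>+t. indicator {0<..<1} r * indicator {0<..<1} t * ennreal (2 * r) * indicator {p. slope p = s} (1 - r, r * t) \<partial>lborel) = 0"
      by simp
  qed
  finally have "(\<integral>\<^sup>+p. indicator {p. slope p = s} p \<partial>tri) = 0" by simp
  hence "AE p in tri. indicator {p. slope p = s} p = (0 :: ennreal)"
    by (subst (asm) nn_integral_0_iff_AE) auto
  thus ?thesis by eventually_elim (auto simp: indicator_def split: if_splits)
qed

lemma measurable_slope_component:
  assumes "i \<in> I"
  shows "(\<lambda>x. slope (x i)) \<in> borel_measurable (triM I)"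
proof -
  have "slope \<in> borel_measurable tri" by (simp add: measurable_cong_sets[OF sets_tri refl])
  from measurable_compose[OF measurable_component_singleton[OF assms] this] show ?thesis .
qed

lemma measurable_indicator_slope_less:
  assumes "i \<in> I" "j \<in> I"
  shows "(\<lambda>x. indicator {slope (x i)<..} (slope (x j)) :: ennreal) \<in> borel_measurable (triM I)"
proof -
  note [measurable] = assms[THEN measurable_slope_component]
  have "Measurable.pred (triM I) (\<lambda>x. slope (x i) < slope (x j))" by measurable
  hence "(\<lambda>x. indicator {x. slope (x i) < slope (x j)} x :: ennreal) \<in> borel_measurable (triM I)"
    by (intro borel_measurable_indicator') (auto simp: pred_def)
  thus ?thesis by (simp add: indicator_def)
qed

lemma AE_slopes_distinct:
  assumes "finite I"
  shows "AE x in triM I. inj_on (\<lambda>i. slope (x i)) I"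
proof -
  have "AE x in triM I. slope (x i) \<noteq> slope (x j)" if ij: "i \<in> I" "j \<in> I" "i \<noteq> j" for i j
  proof -
    define K where "K = I - {i}"
    have K: "finite K" "i \<notin> K" "insert i K = I" "j \<in> K" using assms ij by (auto simp: K_def)
    let ?f = "\<lambda>x. indicator {x. slope (x i) = slope (x j)} x :: ennreal"
    have m: "?f \<in> borel_measurable (triM I)"
    proof -
      have "Measurable.pred (triM I) (\<lambda>x. slope (x i) = slope (x j))"
      proof -
        note [measurable] = ij(1,2)[THEN measurable_slope_component]
        have "Measurable.pred (triM I) (\<lambda>x. \<not> slope (x i) < slope (x j) \<and> \<not> slope (x j) < slope (x i))"
          by measurable
        moreover have "(\<lambda>x. slope (x i) = slope (x j)) = (\<lambda>x. \<not> slope (x i) < slope (x j) \<and> \<not> slope (x j) < slope (x i))"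
          by (auto simp: fun_eq_iff)
        ultimately show ?thesis by (simp only:)
      qed
      thus ?thesis
        by (intro borel_measurable_indicator') (auto simp: pred_def)
    qed
    have "(\<integral>\<^sup>+x. ?f x \<partial>triM I) = (\<integral>\<^sup>+x. \<integral>\<^sup>+y. ?f (x(i := y)) \<partial>tri \<partial>triM K)"
      using tris.product_nn_integral_insert[OF K(1,2), of ?f] m K(3) by simp
    also have "\<dots> = (\<integral>\<^sup>+x. \<integral>\<^sup>+y. 0 \<partial>tri \<partial>triM K)"
    proof (rule nn_integral_cong, rule nn_integral_cong_AE)
      fix x :: "nat \<Rightarrow> real \<times> real"
      show "AE y in tri. ?f (x(i := y)) = 0"
        using AE_slope_neq[of "slope (x j)"] by eventually_elim (use ij in \<open>auto simp: indicator_def\<close>)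
    qed
    finally have "(\<integral>\<^sup>+x. ?f x \<partial>triM I) = 0" by simp
    hence "AE x in triM I. ?f x = 0" using m by (subst (asm) nn_integral_0_iff_AE) auto
    thus ?thesis by eventually_elim (auto simp: indicator_def split: if_splits)
  qed
  hence "AE x in triM I. \<forall>i\<in>I. \<forall>j\<in>I. i \<noteq> j \<longrightarrow> slope (x i) \<noteq> slope (x j)"
    using assms by (intro AE_finite_allI) (auto)
  thus ?thesis by eventually_elim (auto simp: inj_on_def)
qed

lemma lowest_slope_partition:
  fixes s :: "nat \<Rightarrow> real"
  assumes "finite I" "I \<noteq> {}" "inj_on s I"
  shows "(\<Sum>i\<in>I. \<Prod>j\<in>I - {i}. indicator {s i<..} (s j)) = (1 :: ennreal)"
proof -
  obtain m where m: "m \<in> I" "\<And>j. j \<in> I \<Longrightarrow> s m \<le> s j"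
    using ex_min_if_finite[of "s ` I"] assms(1,2) by (metis (mono_tags, lifting) finite_imageI imageE image_eqI image_is_empty leI)
  have "(\<Prod>j\<in>I - {i}. indicator {s i<..} (s j)) = (if i = m then 1 else 0 :: ennreal)" if "i \<in> I" for i
  proof (cases "i = m")
    case True
    have "s m < s j" if "j \<in> I - {m}" for j
      using m(2)[of j] inj_onD[OF assms(3), of m j] m(1) that by force
    thus ?thesis using True by (auto intro!: prod.neutral)
  next
    case False
    have "(\<Prod>j\<in>I - {i}. indicator {s i<..} (s j)) = (0 :: ennreal)"
      using assms(1) m that False by (intro prod_zero bexI[of _ m]) (auto simp: indicator_def not_less)
    thus ?thesis using False by simp
  qed
  hence "(\<Sum>i\<in>I. \<Prod>j\<in>I - {i}. indicator {s i<..} (s j)) = (\<Sum>i\<in>I. if i = m then 1 else 0 :: ennreal)"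
    by (intro sum.cong) auto
  thus ?thesis using m assms by simp
qed

lemma sum_Pow_card:
  fixes f :: "nat \<Rightarrow> real"
  assumes "finite K"
  shows "(\<Sum>J\<in>Pow K. f (card J)) = (\<Sum>m\<le>card K. real (card K choose m) * f m)"
proof -
  have "(\<Sum>m\<le>card K. sum (\<lambda>J. f (card J)) {J\<in>Pow K. card J = m}) = (\<Sum>J\<in>Pow K. f (card J))"
    using assms by (intro sum.group) (auto intro: card_mono)
  moreover have "sum (\<lambda>J. f (card J)) {J\<in>Pow K. card J = m} = real (card K choose m) * f m" for m
  proof -
    have "sum (\<lambda>J. f (card J)) {J\<in>Pow K. card J = m} = (\<Sum>J\<in>{J. J \<subseteq> K \<and> card J = m}. f m)"
      by (intro sum.cong) auto
    thus ?thesis by (simp only: sum_constant n_subsets[OF assms])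
  qed
  ultimately show ?thesis by (simp only:)
qed

text \<open>The contribution of the event that point \<open>i\<close> is the lowest. In the polar coordinates \<open>(r, t)\<close> of that
point, \<open>1 - r\<close> is the scale of the corner. A set \<open>J\<close> of \<open>m\<close> out of the other \<open>k\<close> points contributes
\<open>2 z g(m) r\<^bsup>k - m + 1\<^esup> (1 - r)\<^sup>m (1 - t)\<^sup>k\<close>; the integrals are Beta functions, and summing over \<open>J\<close> gives
the weights \<open>2 (n - m) / (n (n + 1))\<close> for \<open>n = k + 1\<close>. The last division by \<open>k + 1\<close> is compensated by the \<open>n\<close>
choices of \<open>i\<close>.\<close>

lemma pgf_lowest_term:
  assumes I: "finite I" "i \<in> I" and z: "z \<ge> 0"
    and IH: "\<And>J. J \<subseteq> I - {i} \<Longrightarrow> pgf J z = ennreal (g (card J))" and g: "\<And>m. g m \<ge> 0"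
    and n: "card I = Suc k"
  shows "(\<integral>\<^sup>+x. ennreal (z ^ chain_vertices (x ` I)) * (\<Prod>j\<in>I - {i}. indicator {slope (x i)<..} (slope (x j))) \<partial>triM I) =
    ennreal (z * (2 / (real (k + 1) * real (k + 2))) * (\<Sum>m<Suc k. real (Suc k - m) * g m) / real (k + 1))"
proof -
  define K where "K = I - {i}"
  have K: "finite K" "i \<notin> K" "insert i K = I" "card K = k" using I n by (auto simp: K_def)
  let ?f = "\<lambda>x. ennreal (z ^ chain_vertices (x ` I)) * (\<Prod>j\<in>K. indicator {slope (x i)<..} (slope (x j)))"
  let ?h = "\<lambda>w. \<integral>\<^sup>+x. ennreal (z ^ chain_vertices (insert w (x ` K))) * (\<Prod>j\<in>K. indicator {slope w<..} (slope (x j))) \<partial>triM K"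
  have upd: "(\<lambda>x. (snd x)(i := fst x)) \<in> measurable (tri \<Otimes>\<^sub>M triM K) (triM I)"
    using K by (intro measurable_fun_upd[where J = K]) auto
  have m: "?f \<in> borel_measurable (triM I)"
  proof -
    have "(\<lambda>x. indicator {slope (x i)<..} (slope (x j)) :: ennreal) \<in> borel_measurable (triM I)" if "j \<in> K" for j
      using that I by (intro measurable_indicator_slope_less) (auto simp: K_def)
    thus ?thesis using I K
      by (intro borel_measurable_times_ennreal borel_measurable_prod_ennreal) auto
  qed
  have fh: "?f (x(i := w)) = ennreal (z ^ chain_vertices (insert w (x ` K))) * (\<Prod>j\<in>K. indicator {slope w<..} (slope (x j)))" for x w
  proof -
    have "(x(i := w)) ` I = insert w (x ` K)" using K(2) unfolding K(3)[symmetric] by auto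
    moreover have "(\<Prod>j\<in>K. indicator {slope w<..} (slope ((x(i := w)) j))) = (\<Prod>j\<in>K. indicator {slope w<..} (slope (x j)) :: ennreal)"
      using K(2) by (intro prod.cong) auto
    ultimately show ?thesis by simp
  qed
  have hm: "?h \<in> borel_measurable borel"
  proof -
    have "(\<lambda>x. ?f ((snd x)(i := fst x))) \<in> borel_measurable (tri \<Otimes>\<^sub>M triM K)"
      using upd m by (rule measurable_compose)
    hence "?h \<in> borel_measurable tri"
      unfolding fh by (intro borel_measurable_nn_integral_triM) (auto simp: split_beta)
    thus ?thesis by (simp add: measurable_cong_sets[OF sets_tri refl])
  qed
  define term_value where "term_value m = 2 * z * g m * (fact (Suc (k - m)) * fact m / fact (k + 2)) / real (k + 1)" for m
  define integrand where "integrand J r t = ennreal (2 * z * g (card J) * (r ^ Suc (k - card J) * (1 - r) ^ card J)) * ennreal ((1 - t) ^ k)"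
    for J :: "nat set" and r t :: real
  have "(\<integral>\<^sup>+x. ?f x \<partial>triM I) = (\<integral>\<^sup>+w. ?h w \<partial>tri)"
    using tris.product_nn_integral_insert_rev[OF K(1,2), of ?f, unfolded K(3), OF m] unfolding fh .
  also have "\<dots> = (\<integral>\<^sup>+r. \<integral>\<^sup>+t. indicator {0<..<1} r * indicator {0<..<1} t * ennreal (2 * r) * ?h (1 - r, r * t) \<partial>lborel \<partial>lborel)"
    by (rule nn_integral_tri_polar[OF hm])
  also have "\<dots> = (\<integral>\<^sup>+r. \<integral>\<^sup>+t. (\<Sum>J\<in>Pow K. indicator {0<..<1} r * (indicator {0<..<1} t * integrand J r t)) \<partial>lborel \<partial>lborel)"
  proof (intro nn_integral_cong)
    fix r t :: real
    show "indicator {0<..<1} r * indicator {0<..<1} t * ennreal (2 * r) * ?h (1 - r, r * t) =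
      (\<Sum>J\<in>Pow K. indicator {0<..<1} r * (indicator {0<..<1} t * integrand J r t))"
    proof (cases "r \<in> {0<..<1} \<and> t \<in> {0<..<1}")
      case True
      hence rt: "0 < r" "r < 1" "0 < t" "t < 1" by auto
      have "?h (1 - r, r * t) = (\<integral>\<^sup>+x. ennreal (z ^ chain_vertices (insert (1 - r, t * (1 - (1 - r))) (x ` K))) * (\<Prod>j\<in>K. indicator (corner t 1) (x j)) \<partial>triM K)"
      proof (rule nn_integral_cong_AE)
        have "AE x in triM K. \<forall>j\<in>K. x j \<in> open_triangle"
          using K by (intro AE_finite_allI AE_PiM_component prob_space_tri AE_tri) auto
        thus "AE x in triM K. ennreal (z ^ chain_vertices (insert (1 - r, r * t) (x ` K))) * (\<Prod>j\<in>K. indicator {slope (1 - r, r * t)<..} (slope (x j))) =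
          ennreal (z ^ chain_vertices (insert (1 - r, t * (1 - (1 - r))) (x ` K))) * (\<Prod>j\<in>K. indicator (corner t 1) (x j))"
        proof eventually_elim
          case (elim x)
          have "(\<Prod>j\<in>K. indicator {slope (1 - r, r * t)<..} (slope (x j))) = (\<Prod>j\<in>K. indicator (corner t 1) (x j) :: ennreal)"
            using elim rt by (intro prod.cong) (auto simp: slope_polar indicator_def corner_1_slope slope_def[of "x _"])
          thus ?case by (simp add: mult.commute)
        qed
      qed
      also have "\<dots> = (\<Sum>J\<in>Pow K. ennreal ((1 - r) * (1 - t)) ^ card J * (ennreal z * pgf J z * ennreal ((1 - (1 - r)) * (1 - t)) ^ card (K - J)))"
        using rt K z by (intro nn_integral_corner_condition) auto
      finally have "ennreal (2 * r) * ?h (1 - r, r * t) =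
         (\<Sum>J\<in>Pow K. ennreal (2 * r) * (ennreal ((1 - r) * (1 - t)) ^ card J * (ennreal z * pgf J z * ennreal (r * (1 - t)) ^ card (K - J))))"
        by (simp add: sum_distrib_left)
      also have "\<dots> = (\<Sum>J\<in>Pow K. integrand J r t)"
      proof (rule sum.cong[OF refl])
        fix J assume "J \<in> Pow K"
        hence J: "J \<subseteq> K" by auto
        have c: "card (K - J) = k - card J" "card J \<le> k"
          using J K by (auto simp: card_Diff_subset finite_subset card_mono)
        have "ennreal (2 * r) * (ennreal ((1 - r) * (1 - t)) ^ card J * (ennreal z * pgf J z * ennreal (r * (1 - t)) ^ card (K - J))) =
          ennreal (2 * r * (((1 - r) * (1 - t)) ^ card J * (z * g (card J) * (r * (1 - t)) ^ card (K - J))))"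
        proof -
          have "ennreal a * (ennreal b ^ m * (ennreal c * ennreal d * ennreal e ^ l)) = ennreal (a * (b ^ m * (c * d * e ^ l)))"
            if "0 \<le> a" "0 \<le> b" "0 \<le> c" "0 \<le> d" "0 \<le> e" for a b c d e :: real and m l :: nat
            using that by (simp add: ennreal_mult ennreal_power)
          from this[of "2 * r" "(1 - r) * (1 - t)" z "g (card J)" "r * (1 - t)"] show ?thesis
            unfolding IH[OF J[unfolded K_def]] using rt z g by simp
        qed
        also have "2 * r * (((1 - r) * (1 - t)) ^ card J * (z * g (card J) * (r * (1 - t)) ^ card (K - J))) =
          (2 * z * g (card J) * (r ^ Suc (k - card J) * (1 - r) ^ card J)) * (1 - t) ^ k"
        proof -
          have "(1 - t) ^ k = (1 - t) ^ card J * (1 - t) ^ (k - card J)" using c by (simp flip: power_add)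
          thus ?thesis by (simp add: c power_mult_distrib)
        qed
        finally show "ennreal (2 * r) * (ennreal ((1 - r) * (1 - t)) ^ card J * (ennreal z * pgf J z * ennreal (r * (1 - t)) ^ card (K - J))) = integrand J r t"
          unfolding integrand_def using rt z g by (simp add: ennreal_mult)
      qed
      finally show ?thesis using True by simp
    next
      case False
      hence "(indicator {0<..<1} r :: ennreal) = 0 \<or> (indicator {0<..<1} t :: ennreal) = 0"
        by (auto simp: indicator_def)
      thus ?thesis
        by (elim disjE) (simp_all only: mult_zero_left mult_zero_right sum.neutral_const)
    qed
  qed
  also have "\<dots> = (\<Sum>J\<in>Pow K. \<integral>\<^sup>+r. \<integral>\<^sup>+t. indicator {0<..<1} r * (indicator {0<..<1} t * integrand J r t) \<partial>lborel \<partial>lborel)"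
  proof -
    have [measurable]: "(\<lambda>(r, t). indicator {0<..<1::real} r * (indicator {0<..<1::real} t * integrand J r t)) \<in> borel_measurable (lborel \<Otimes>\<^sub>M lborel)" for J
      unfolding integrand_def by measurable
    show ?thesis
      by (simp add: nn_integral_sum lborel.borel_measurable_nn_integral)
  qed
  also have "\<dots> = (\<Sum>J\<in>Pow K. ennreal (term_value (card J)))"
  proof (rule sum.cong[OF refl])
    fix J assume "J \<in> Pow K"
    hence c: "card J \<le> k" using K by (auto simp: card_mono)
    let ?a = "2 * z * g (card J)"
    have "(\<integral>\<^sup>+t. indicator {0<..<1} r * (indicator {0<..<1} t * integrand J r t) \<partial>lborel) =
       indicator {0<..<1} r * ennreal (?a * (r ^ Suc (k - card J) * (1 - r) ^ card J)) * ennreal (1 / real (k + 1))" for r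
    proof -
      have "(\<integral>\<^sup>+t. indicator {0<..<1} r * (indicator {0<..<1} t * integrand J r t) \<partial>lborel) =
        (\<integral>\<^sup>+t. indicator {0<..<1} r * ennreal (?a * (r ^ Suc (k - card J) * (1 - r) ^ card J)) * (indicator {0<..<1} t * ennreal (t ^ 0 * (1 - t) ^ k)) \<partial>lborel)"
        by (intro nn_integral_cong) (simp add: integrand_def mult_ac)
      also have "\<dots> = indicator {0<..<1} r * ennreal (?a * (r ^ Suc (k - card J) * (1 - r) ^ card J)) * (\<integral>\<^sup>+t. indicator {0<..<1} t * ennreal (t ^ 0 * (1 - t) ^ k) \<partial>lborel)"
        by (intro nn_integral_cmult) measurable
      also have "(\<integral>\<^sup>+t. indicator {0<..<1} t * ennreal (t ^ 0 * (1 - t) ^ k) \<partial>lborel) = ennreal (1 / real (k + 1))"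
      proof -
        have "fact (k + 1) = real (k + 1) * fact k" by simp
        hence "fact 0 * fact k / fact (0 + k + 1) = 1 / real (k + 1)" by (simp del: fact_Suc)
        thus ?thesis by (simp only: nn_integral_beta)
      qed
      finally show ?thesis .
    qed
    hence "(\<integral>\<^sup>+r. \<integral>\<^sup>+t. indicator {0<..<1} r * (indicator {0<..<1} t * integrand J r t) \<partial>lborel \<partial>lborel) =
      (\<integral>\<^sup>+r. ennreal (?a * (1 / real (k + 1))) * (indicator {0<..<1} r * ennreal (r ^ Suc (k - card J) * (1 - r) ^ card J)) \<partial>lborel)"
    proof (simp only:, intro nn_integral_cong)
      fix r :: real
      have gen: "ennreal (a * q) * ennreal b = ennreal (a * b) * ennreal q" if "0 \<le> a" "0 \<le> q" "0 \<le> b" for a b q :: real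
        using that by (simp add: ennreal_mult mult_ac)
      show "indicator {0<..<1} r * ennreal (?a * (r ^ Suc (k - card J) * (1 - r) ^ card J)) * ennreal (1 / real (k + 1)) =
        ennreal (?a * (1 / real (k + 1))) * (indicator {0<..<1} r * ennreal (r ^ Suc (k - card J) * (1 - r) ^ card J))"
      proof (cases "r \<in> {0<..<1}")
        case True
        hence "0 \<le> r ^ Suc (k - card J) * (1 - r) ^ card J" by simp
        from gen[OF _ this, of ?a "1 / real (k + 1)"] show ?thesis using True z g by simp
      qed simp
    qed
    also have "\<dots> = ennreal (?a * (1 / real (k + 1))) * ennreal (fact (Suc (k - card J)) * fact (card J) / fact (Suc (k - card J) + card J + 1))"
      by (subst nn_integral_cmult) (simp_all only: nn_integral_beta, measurable)
    also have "Suc (k - card J) + card J + 1 = k + 2" using c by simp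
    also have "ennreal (?a * (1 / real (k + 1))) * ennreal (fact (Suc (k - card J)) * fact (card J) / fact (k + 2)) = ennreal (term_value (card J))"
      using z g unfolding term_value_def by (subst ennreal_mult[symmetric]) (auto simp: mult_ac)
    finally show "(\<integral>\<^sup>+r. \<integral>\<^sup>+t. indicator {0<..<1} r * (indicator {0<..<1} t * integrand J r t) \<partial>lborel \<partial>lborel) = ennreal (term_value (card J))" .
  qed
  also have "\<dots> = ennreal (\<Sum>J\<in>Pow K. term_value (card J))"
    using z g by (intro sum_ennreal) (auto simp: term_value_def)
  also have "(\<Sum>J\<in>Pow K. term_value (card J)) = (\<Sum>m\<le>k. real (k choose m) * term_value m)"
    using sum_Pow_card[OF K(1), of term_value] K by simp
  also have "\<dots> = (\<Sum>m<Suc k. z * (2 / (real (k + 1) * real (k + 2))) * (real (Suc k - m) * g m) / real (k + 1))"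
  proof (rule sum.cong)
    fix m assume "m \<in> {..<Suc k}"
    hence m: "m \<le> k" by simp
    have "real (k choose m) * (fact (Suc (k - m)) * fact m / fact (k + 2)) = real (Suc k - m) / (real (k + 1) * real (k + 2))"
    proof -
      have b: "real (k choose m) = fact k / (fact m * fact (k - m))" using binomial_fact[OF m, where ?'a = real] .
      have c: "fact (k + 2) = real (k + 2) * (real (k + 1) * fact k)"
        by (simp add: numeral_2_eq_2 algebra_simps)
      have d: "fact (Suc (k - m)) = real (Suc k - m) * fact (k - m)" using m by (simp add: Suc_diff_le)
      have "F / (M * D) * ((s * D) * M / (p * (q * F))) = s / (q * p)"
        if "F \<noteq> 0" "M \<noteq> 0" "D \<noteq> 0" for F M D s p q :: real
        using that by simp
      thus ?thesis unfolding b c d by (metis fact_nonzero)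
    qed
    note X = this
    have "real (k choose m) * term_value m = (real (k choose m) * (fact (Suc (k - m)) * fact m / fact (k + 2))) * (2 * z * g m / real (k + 1))"
      by (simp add: term_value_def del: fact_Suc)
    also have "\<dots> = z * (2 / (real (k + 1) * real (k + 2))) * (real (Suc k - m) * g m) / real (k + 1)"
      unfolding X by (simp add: mult_ac)
    finally show "real (k choose m) * term_value m = z * (2 / (real (k + 1) * real (k + 2))) * (real (Suc k - m) * g m) / real (k + 1)" .
  qed auto
  also have "\<dots> = z * (2 / (real (k + 1) * real (k + 2))) * (\<Sum>m<Suc k. real (Suc k - m) * g m) / real (k + 1)"
    by (simp only: sum_distrib_left sum_divide_distrib)
  finally show ?thesis unfolding K_def .
qed

text \<open>Almost surely exactly one point is the lowest, so the previous contributions add up to the renewal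
equation that defines \<open>chain_poly\<close>. The factor \<open>z\<^sup>2\<close> accounts for \<open>v\<^sub>1\<close> and \<open>v\<^sub>2\<close>.\<close>

lemma pgf_chain_vertices:
  assumes "finite I" "z > 0"
  shows "pgf I z = ennreal (z\<^sup>2 * poly (chain_poly (card I)) z)"
  using assms(1)
proof (induction "card I" arbitrary: I rule: less_induct)
  case less
  show ?case
  proof (cases "I = {}")
    case True
    thus ?thesis
      by (simp add: pgf_def chain_vertices_empty PiM_empty nn_integral_count_space_finite)
  next
    case False
    then obtain k where k: "card I = Suc k" using less.prems by (metis card_eq_0_iff not0_implies_Suc)
    define g where "g m = z\<^sup>2 * poly (chain_poly m) z" for m
    have g: "g m \<ge> 0" for m using chain_poly_pos[OF assms(2), of m] by (simp add: g_def)
    let ?D = "\<lambda>i x. (\<Prod>j\<in>I - {i}. indicator {slope (x i)<..} (slope (x j))) :: ennreal"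
    have "pgf I z = (\<integral>\<^sup>+x. (\<Sum>i\<in>I. ennreal (z ^ chain_vertices (x ` I)) * ?D i x) \<partial>triM I)"
      unfolding pgf_def
    proof (rule nn_integral_cong_AE)
      show "AE x in triM I. ennreal (z ^ chain_vertices (x ` I)) = (\<Sum>i\<in>I. ennreal (z ^ chain_vertices (x ` I)) * ?D i x)"
        using AE_slopes_distinct[OF less.prems]
      proof eventually_elim
        case (elim x)
        have "(\<Sum>i\<in>I. ?D i x) = 1" using lowest_slope_partition[OF less.prems False elim] .
        thus ?case by (simp only: sum_distrib_left[symmetric] mult_1_right)
      qed
    qed
    also have "\<dots> = (\<Sum>i\<in>I. \<integral>\<^sup>+x. ennreal (z ^ chain_vertices (x ` I)) * ?D i x \<partial>triM I)"
    proof (rule nn_integral_sum)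
      fix i assume i: "i \<in> I"
      have "(\<lambda>x. indicator {slope (x i)<..} (slope (x j)) :: ennreal) \<in> borel_measurable (triM I)" if "j \<in> I" for j
        using that i by (intro measurable_indicator_slope_less)
      thus "(\<lambda>x. ennreal (z ^ chain_vertices (x ` I)) * ?D i x) \<in> borel_measurable (triM I)"
        using less.prems by (intro borel_measurable_times_ennreal borel_measurable_prod_ennreal) auto
    qed
    also have "\<dots> = (\<Sum>i\<in>I. ennreal (z * (2 / (real (k + 1) * real (k + 2))) * (\<Sum>m<Suc k. real (Suc k - m) * g m) / real (k + 1)))"
    proof (rule sum.cong[OF refl])
      fix i assume i: "i \<in> I"
      show "(\<integral>\<^sup>+x. ennreal (z ^ chain_vertices (x ` I)) * ?D i x \<partial>triM I) =
        ennreal (z * (2 / (real (k + 1) * real (k + 2))) * (\<Sum>m<Suc k. real (Suc k - m) * g m) / real (k + 1))"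
      proof (rule pgf_lowest_term[OF less.prems i _ _ g k])
        fix J assume J: "J \<subseteq> I - {i}"
        hence "J \<subset> I" using i by auto
        thus "pgf J z = ennreal (g (card J))"
          unfolding g_def using less.prems by (intro less.hyps psubset_card_mono finite_subset[of J I]) auto
      qed (use assms in auto)
    qed
    also have "\<dots> = ennreal (real (k + 1) * (z * (2 / (real (k + 1) * real (k + 2))) * (\<Sum>m<Suc k. real (Suc k - m) * g m) / real (k + 1)))"
      (is "(\<Sum>i\<in>I. ennreal ?C) = _")
    proof -
      have "?C \<ge> 0" using g assms by (intro divide_nonneg_nonneg mult_nonneg_nonneg sum_nonneg) auto
      hence "(\<Sum>i\<in>I. ennreal ?C) = ennreal (\<Sum>i\<in>I. ?C)" by (intro sum_ennreal)
      thus ?thesis by (simp only: sum_constant k Suc_eq_plus1)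
    qed
    also have "real (k + 1) * (z * (2 / (real (k + 1) * real (k + 2))) * (\<Sum>m<Suc k. real (Suc k - m) * g m) / real (k + 1)) =
      z\<^sup>2 * poly (chain_poly (card I)) z"
    proof -
      have "(\<Sum>m<Suc k. real (Suc k - m) * g m) = z\<^sup>2 * (\<Sum>m<Suc k. real (Suc k - m) * poly (chain_poly m) z)"
        unfolding sum_distrib_left by (intro sum.cong) (auto simp: g_def mult_ac)
      thus ?thesis by (simp add: k poly_chain_poly_renewal del: sum.lessThan_Suc)
    qed
    finally show ?thesis .
  qed
qed

section \<open>The law of the number of vertices\<close>

lemma bexp_eq_sum_coeff:
  assumes "length ps \<le> L"
  shows "bexp ps f = (\<Sum>k\<le>L. coeff (bernoulli_poly ps) k * f k)"
  using assms
proof (induction ps arbitrary: f L)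
  case Nil
  have "(\<Sum>k\<le>L. coeff (1 :: real poly) k * f k) = (\<Sum>k\<le>L. if k = 0 then f 0 else 0)"
    by (intro sum.cong) auto
  thus ?case by simp
next
  case (Cons p ps)
  obtain L' where L: "L = Suc L'" "length ps \<le> L'" using Cons.prems by (cases L) auto
  have "(\<Sum>k\<le>Suc L'. coeff (bernoulli_poly (p # ps)) k * f k) =
     (\<Sum>k\<le>Suc L'. (1 - p) * (coeff (bernoulli_poly ps) k * f k)
        + p * (coeff (pCons 0 (bernoulli_poly ps)) k * f k))"
    by (intro sum.cong) (auto simp: algebra_simps coeff_pCons split: nat.splits)
  also have "\<dots> = (1 - p) * (\<Sum>k\<le>Suc L'. coeff (bernoulli_poly ps) k * f k)
      + p * (\<Sum>k\<le>Suc L'. coeff (pCons 0 (bernoulli_poly ps)) k * f k)"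
    by (simp only: sum.distrib sum_distrib_left)
  also have "(\<Sum>k\<le>Suc L'. coeff (pCons 0 (bernoulli_poly ps)) k * f k) =
     (\<Sum>k\<le>L'. coeff (bernoulli_poly ps) k * f (Suc k))"
    by (subst sum.atMost_Suc_shift) simp
  also have "(1 - p) * (\<Sum>k\<le>Suc L'. coeff (bernoulli_poly ps) k * f k) +
     p * (\<Sum>k\<le>L'. coeff (bernoulli_poly ps) k * f (Suc k)) = bexp (p # ps) f"
    using Cons.IH[of "Suc L'" f] Cons.IH[of L' "\<lambda>k. f (Suc k)"] L by simp
  finally show ?case using L by simp
qed

lemma (in prob_space) expectation_bounded_nat:
  fixes N :: "'a \<Rightarrow> nat"
  assumes N: "N \<in> measurable M (count_space UNIV)" and b: "\<And>\<omega>. N \<omega> \<le> m"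
  shows "integrable M (\<lambda>\<omega>. f (N \<omega>) :: real)"
    and "expectation (\<lambda>\<omega>. f (N \<omega>)) = (\<Sum>k\<le>m. prob {\<omega>\<in>space M. N \<omega> = k} * f k)"
proof -
  have sets: "{\<omega>\<in>space M. N \<omega> = k} \<in> events" for k
    using measurable_sets[OF N, of "{k}"] by (simp add: vimage_def Int_def conj_commute)
  have eq: "f (N \<omega>) = (\<Sum>k\<le>m. indicator {\<omega>\<in>space M. N \<omega> = k} \<omega> * f k)" if "\<omega> \<in> space M" for \<omega>
  proof -
    have "(\<Sum>k\<le>m. indicator {\<omega>\<in>space M. N \<omega> = k} \<omega> * f k) = (\<Sum>k\<le>m. if k = N \<omega> then f k else 0)"
      using that by (intro sum.cong) (auto simp: indicator_def)
    thus ?thesis using b[of \<omega>] by simp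
  qed
  have int: "integrable M (\<lambda>\<omega>. indicator {\<omega>\<in>space M. N \<omega> = k} \<omega> * f k)" for k
    using sets by (intro integrable_mult_left integrable_real_indicator) (auto simp: emeasure_eq_measure)
  show "integrable M (\<lambda>\<omega>. f (N \<omega>))"
  proof (rule Bochner_Integration.integrable_cong[OF refl eq, THEN iffD2])
    show "integrable M (\<lambda>\<omega>. \<Sum>k\<le>m. indicator {\<omega>\<in>space M. N \<omega> = k} \<omega> * f k)"
      by (intro Bochner_Integration.integrable_sum int)
  qed
  have "expectation (\<lambda>\<omega>. f (N \<omega>)) = expectation (\<lambda>\<omega>. \<Sum>k\<le>m. indicator {\<omega>\<in>space M. N \<omega> = k} \<omega> * f k)"
    by (intro Bochner_Integration.integral_cong eq) auto
  also have "\<dots> = (\<Sum>k\<le>m. expectation (\<lambda>\<omega>. indicator {\<omega>\<in>space M. N \<omega> = k} \<omega> * f k))"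
    by (intro Bochner_Integration.integral_sum int)
  also have "\<dots> = (\<Sum>k\<le>m. prob {\<omega>\<in>space M. N \<omega> = k} * f k)"
    using sets by simp
  finally show "expectation (\<lambda>\<omega>. f (N \<omega>)) = (\<Sum>k\<le>m. prob {\<omega>\<in>space M. N \<omega> = k} * f k)" .
qed

text \<open>The generating function determines the law: \<open>E z\<^sup>N\<close> and \<open>z\<^sup>2\<close> times the generating polynomial of the Bernoulli
sum are polynomials in \<open>z\<close> that agree for all \<open>z > 0\<close>, hence have equal coefficients.\<close>

lemma (in prob_space) vertex_number_law:
  fixes X :: "nat \<Rightarrow> 'a \<Rightarrow> real \<times> real" and n :: nat
  defines "N \<equiv> \<lambda>\<omega>. num_vertices (random_polygon X n \<omega>)"
  assumes indep: "indep_vars (\<lambda>_. borel) X {1..n}"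
    and unif: "\<And>i. i \<in> {1..n} \<Longrightarrow> distr M lborel (X i) = uniform_measure lborel std_triangle"
    and n: "n \<ge> 1"
  obtains ps where "is_probs ps" "bvar ps = chain_var n"
    "\<And>f. expectation (\<lambda>\<omega>. f (N \<omega>)) = bexp ps (\<lambda>k. f (k + 2))"
proof -
  let ?I = "{1..n}"
  have rv: "random_variable borel (X i)" if "i \<in> ?I" for i
    using indep that by (auto simp: indep_vars_def)
  have N_eq: "N \<omega> = chain_vertices ((\<lambda>i. X i \<omega>) ` ?I)" for \<omega>
    by (simp add: N_def random_polygon_def chain_vertices_def)
  have N: "N \<in> measurable M (count_space UNIV)"
    unfolding N_eq[abs_def] by (intro measurable_chain_vertices rv) auto
  have bound: "N \<omega> \<le> n + 2" for \<omega>
  proof -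
    let ?S = "{(1, 0), (0, 1)} \<union> (\<lambda>i. X i \<omega>) ` ?I"
    have "N \<omega> \<le> card ?S"
      unfolding N_eq chain_vertices_def by (subst num_vertices_hull_finite) (auto intro!: card_mono)
    also have "\<dots> \<le> card {(1, 0), (0, 1 :: real) :: real \<times> real} + card ((\<lambda>i. X i \<omega>) ` ?I)" by (rule card_Un_le)
    also have "\<dots> \<le> 2 + card ?I" by (intro add_mono card_image_le) auto
    finally show ?thesis by simp
  qed
  have "distr M (Pi\<^sub>M ?I (\<lambda>_. borel)) (\<lambda>\<omega>. \<lambda>i\<in>?I. X i \<omega>) = Pi\<^sub>M ?I (\<lambda>i. distr M borel (X i))"
    using indep_vars_iff_distr_eq_PiM'[of ?I X "\<lambda>_. borel"] rv indep n by auto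
  also have "\<dots> = triM ?I"
  proof (rule PiM_cong[OF refl])
    fix i assume i: "i \<in> ?I"
    have "distr M borel (X i) = distr M lborel (X i)" by (rule distr_cong) auto
    thus "distr M borel (X i) = tri" using unif[OF i] uniform_measure_std_triangle by simp
  qed
  finally have law: "distr M (Pi\<^sub>M ?I (\<lambda>_. borel)) (\<lambda>\<omega>. \<lambda>i\<in>?I. X i \<omega>) = triM ?I" .
  have gen: "expectation (\<lambda>\<omega>. z ^ N \<omega>) = z\<^sup>2 * poly (chain_poly n) z" if z: "z > 0" for z :: real
  proof -
    have Xm: "(\<lambda>\<omega>. \<lambda>i\<in>?I. X i \<omega>) \<in> measurable M (Pi\<^sub>M ?I (\<lambda>_. borel))"
      by (intro measurable_restrict rv)
    have "(\<lambda>x. ennreal (z ^ chain_vertices (x ` ?I))) \<in> borel_measurable (Pi\<^sub>M ?I (\<lambda>_. borel))"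
      using measurable_chain_vertices[of ?I "\<lambda>i x. x i" "Pi\<^sub>M ?I (\<lambda>_. borel)"] by simp
    hence "(\<integral>\<^sup>+\<omega>. ennreal (z ^ chain_vertices ((\<lambda>i\<in>?I. X i \<omega>) ` ?I)) \<partial>M) = pgf ?I z"
      unfolding pgf_def law[symmetric] by (subst nn_integral_distr[OF Xm]) auto
    also have "\<dots> = ennreal (z\<^sup>2 * poly (chain_poly n) z)"
      using pgf_chain_vertices[of ?I z] z by simp
    also have "(\<integral>\<^sup>+\<omega>. ennreal (z ^ chain_vertices ((\<lambda>i\<in>?I. X i \<omega>) ` ?I)) \<partial>M) = (\<integral>\<^sup>+\<omega>. ennreal (z ^ N \<omega>) \<partial>M)"
      by (simp add: N_eq)
    also have "\<dots> = ennreal (expectation (\<lambda>\<omega>. z ^ N \<omega>))"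
      using z expectation_bounded_nat(1)[OF N bound, of "\<lambda>k. z ^ k"] by (intro nn_integral_eq_integral) auto
    finally show ?thesis
      using z chain_poly_pos[OF z, of n] by (subst (asm) ennreal_inj) (auto intro!: integral_nonneg)
  qed
  obtain ps where ps: "is_probs ps" "chain_poly n = bernoulli_poly ps" "bvar ps = chain_var n"
    by (rule chain_poly_bernoulli_variance)
  define P where "P k = prob {\<omega>\<in>space M. N \<omega> = k}" for k
  define p where "p = (\<Sum>k\<le>n + 2. monom (P k) k)"
  have coeff_p: "coeff p k = (if k \<le> n + 2 then P k else 0)" for k
    by (simp add: p_def coeff_sum)
  have "p = monom 1 2 * bernoulli_poly ps"
  proof (rule ccontr)
    assume "p \<noteq> monom 1 2 * bernoulli_poly ps"
    hence "finite {z. poly (p - monom 1 2 * bernoulli_poly ps) z = 0}" by (intro poly_roots_finite) simp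
    moreover have "{0<..} \<subseteq> {z. poly (p - monom 1 2 * bernoulli_poly ps) z = 0}"
    proof
      fix z :: real assume "z \<in> {0<..}"
      hence z: "z > 0" by simp
      have "poly p z = (\<Sum>k\<le>n + 2. P k * z ^ k)" by (simp add: p_def poly_sum poly_monom)
      also have "\<dots> = expectation (\<lambda>\<omega>. z ^ N \<omega>)"
        unfolding P_def by (rule expectation_bounded_nat(2)[OF N bound, symmetric])
      also have "\<dots> = poly (monom 1 2 * bernoulli_poly ps) z"
        by (simp add: gen[OF z] ps poly_monom)
      finally show "z \<in> {z. poly (p - monom 1 2 * bernoulli_poly ps) z = 0}" by simp
    qed
    ultimately have "finite ({0<..} :: real set)" by (rule rev_finite_subset)
    thus False using infinite_Ioi[of "0::real"] by simp
  qed
  hence coeff_eq: "coeff p k = (if k < 2 then 0 else coeff (bernoulli_poly ps) (k - 2))" for k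
    by (simp add: coeff_monom_mult)
  have "expectation (\<lambda>\<omega>. f (N \<omega>)) = bexp ps (\<lambda>k. f (k + 2))" for f :: "nat \<Rightarrow> real"
  proof -
    let ?L = "n + length ps"
    have "expectation (\<lambda>\<omega>. f (N \<omega>)) = (\<Sum>k\<le>n + 2. P k * f k)"
      unfolding P_def by (rule expectation_bounded_nat(2)[OF N bound])
    also have "\<dots> = (\<Sum>k\<le>Suc (Suc ?L). coeff p k * f k)"
      by (intro sum.mono_neutral_cong_left) (auto simp: coeff_p)
    also have "\<dots> = (\<Sum>k\<le>?L. coeff (bernoulli_poly ps) k * f (k + 2))"
      by (subst sum.atMost_Suc_shift, subst sum.atMost_Suc_shift) (simp add: coeff_eq)
    also have "\<dots> = bexp ps (\<lambda>k. f (k + 2))"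
      by (rule bexp_eq_sum_coeff[symmetric]) simp
    finally show ?thesis .
  qed
  with ps that show ?thesis by blast
qed

lemma (in prob_space) normalized_vertex_number_berry_esseen:
  fixes X :: "nat \<Rightarrow> 'a \<Rightarrow> real \<times> real"
  assumes indep: "indep_vars (\<lambda>_. borel) X {1..n}"
    and unif: "\<And>i. i \<in> {1..n} \<Longrightarrow> distr M lborel (X i) = uniform_measure lborel std_triangle"
    and n: "n \<ge> 1" and pos: "chain_var n > 0"
  shows "\<bar>prob {\<omega>\<in>space M. normalize_rv M (\<lambda>\<omega>. real (num_vertices (random_polygon X n \<omega>))) \<omega> \<le> x}
     - std_normal_cdf x\<bar> \<le> 9 / sqrt (chain_var n)"
proof -
  define N where "N = (\<lambda>\<omega>. num_vertices (random_polygon X n \<omega>))"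
  obtain ps where ps: "is_probs ps" "bvar ps = chain_var n"
    and law: "\<And>f. expectation (\<lambda>\<omega>. f (N \<omega>)) = bexp ps (\<lambda>k. f (k + 2))"
    unfolding N_def using vertex_number_law[OF indep unif n] by metis
  have mean: "expectation (\<lambda>\<omega>. real (N \<omega>)) = bmean ps + 2"
    using law[of real] bexp_add[of ps real "\<lambda>_. 2"] by (simp add: bexp_mean add.commute)
  have var: "variance (\<lambda>\<omega>. real (N \<omega>)) = bvar ps"
    using law[of "\<lambda>k. (real k - (bmean ps + 2))\<^sup>2"] by (simp add: mean bexp_variance)
  have norm: "normalize_rv M (\<lambda>\<omega>. real (N \<omega>)) \<omega> = (real (N \<omega>) - (bmean ps + 2)) / sqrt (bvar ps)" for \<omega>
    by (simp only: normalize_rv_def var) (simp only: mean)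
  let ?A = "{\<omega>\<in>space M. normalize_rv M (\<lambda>\<omega>. real (N \<omega>)) \<omega> \<le> x}"
  let ?f = "\<lambda>k. if (real k - (bmean ps + 2)) / sqrt (bvar ps) \<le> x then 1 else 0 :: real"
  have "prob ?A = expectation (indicator ?A)"
  proof -
    have "?A \<inter> space M = ?A" by auto
    thus ?thesis by simp
  qed
  also have "\<dots> = expectation (\<lambda>\<omega>. ?f (N \<omega>))"
    by (intro Bochner_Integration.integral_cong) (auto simp: norm indicator_def)
  also have "\<dots> = bexp ps (\<lambda>k. if (real k - bmean ps) / sqrt (bvar ps) \<le> x then 1 else 0)"
    using law[of ?f] by simp
  finally show ?thesis
    using berry_esseen_bernoulli[OF ps(1), of x] pos unfolding ps(2) N_def by simp
qed

theorem theorem3p4: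
  fixes M :: "nat \<Rightarrow> 'a measure"
    and X :: "nat \<Rightarrow> nat \<Rightarrow> 'a \<Rightarrow> real \<times> real"
    and Z :: "nat \<Rightarrow> 'a \<Rightarrow> real"
  assumes "\<And>n. prob_space (M n)"
    and "\<And>n. prob_space.indep_vars (M n) (\<lambda>_. borel) (X n) {1..n}"
    and "\<And>n i. i \<in> {1..n} \<Longrightarrow> distr (M n) lborel (X n i) = uniform_measure lborel std_triangle"
    and "\<And>n. n \<ge> 2 \<Longrightarrow>
      Z n = normalize_rv (M n) (\<lambda>\<omega>. real (num_vertices (random_polygon (X n) n \<omega>)))"
  shows "(\<lambda>n. SUP x. \<bar>measure (M n) {\<omega> \<in> space (M n). Z n \<omega> \<le> x} - std_normal_cdf x\<bar>)
    \<in> O(\<lambda>n. 1 / sqrt (ln (real n)))"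
proof (rule bigoI[where c = "9 * sqrt (27 / 5)"], rule eventually_sequentiallyI[of 4])
  fix n :: nat assume n: "4 \<le> n"
  define D where "D x = \<bar>measure (M n) {\<omega> \<in> space (M n). Z n \<omega> \<le> x} - std_normal_cdf x\<bar>" for x
  have ln: "ln (real n) > 0" using n by simp
  have var: "5 / 27 * ln (real n) \<le> chain_var n" using chain_var_lower_bound[OF n] .
  hence pos: "chain_var n > 0" using ln by (smt (verit) divide_pos_pos mult_pos_pos)
  have D: "D x \<le> 9 / sqrt (chain_var n)" for x
    unfolding D_def
    using prob_space.normalized_vertex_number_berry_esseen[OF assms(1) assms(2) assms(3) _ pos, of x] n assms(4)[of n]
    by auto
  have "(SUP x. D x) \<le> 9 / sqrt (chain_var n)" by (intro cSUP_least D) auto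
  also have "\<dots> \<le> 9 / sqrt (5 / 27 * ln (real n))"
    using ln var pos by (intro divide_left_mono mult_pos_pos) auto
  also have "\<dots> = 9 * sqrt (27 / 5) * (1 / sqrt (ln (real n)))"
    by (simp add: real_sqrt_mult real_sqrt_divide)
  finally have upper: "(SUP x. D x) \<le> 9 * sqrt (27 / 5) * (1 / sqrt (ln (real n)))" .
  have "0 \<le> D 0" by (simp add: D_def)
  also have "\<dots> \<le> (SUP x. D x)"
    using D by (intro cSUP_upper bdd_aboveI2[of _ _ "9 / sqrt (chain_var n)"]) auto
  finally have lower: "0 \<le> (SUP x. D x)" .
  have "norm (1 / sqrt (ln (real n))) = 1 / sqrt (ln (real n))" using ln by simp
  thus "norm (SUP x. \<bar>measure (M n) {\<omega> \<in> space (M n). Z n \<omega> \<le> x} - std_normal_cdf x\<bar>)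
     \<le> 9 * sqrt (27 / 5) * norm (1 / sqrt (ln (real n)))"
    using upper lower unfolding D_def[symmetric] by simp
qed

end
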